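(* Let $M\in\mathbb{S}^{n\times n}$ be invertible with $t^*(M)=+\infty$, and let $t\in\mathbb{R}_{\ge 0}$ be fixed. Given the dynamic programming evolution operator $\mathcal{S}_t$, there exists a max-plus linear max-plus integral operator $\mathcal{G}_t^\oplus$ with $\mathrm{dom}(\mathcal{G}_t^\oplus)=\mathrm{dom}(\mathcal{S}_t)$ such that $$\mathcal{S}_t\,\psi=\mathcal{G}_t^\oplus\,\psi\doteq\int_{\mathbb{R}^n}^\oplus G_t(\cdot,y)\otimes\psi(y)\,dy\qquad\text{for all }\psi\in\mathrm{dom}(\mathcal{G}_t^\oplus),$$ with kernel $G_t:\mathbb{R}^n\times\mathbb{R}^n\to\mathbb{R}\cup\{-\infty\}$ defined for all $x,y\in\mathbb{R}^n$ by $$G_t(x,y)\doteq(\mathcal{S}_t\,\delta^-(\cdot,y))(x)=(\mathcal{D}_\varphi S_t(x,\cdot))(y).$$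
   Context: $\mathbb{S}^{n\times n}$ denotes the real symmetric $n\times n$ matrices; $\mathbb{R}^-\doteq\mathbb{R}\cup\{-\infty\}$; prime denotes transpose. Fix $A\in\mathbb{R}^{n\times n}$, $B\in\mathbb{R}^{n\times m}$, $C\in\mathbb{R}^{p\times n}$. Max-plus operations: $a\oplus b=\max(a,b)$, $a\otimes b=a+b$ on $\mathbb{R}^-$, and $\int_{\mathcal Y}^\oplus f(y)\,dy\doteq\sup_{y\in\mathcal Y}f(y)$. The max-plus delta function is $\delta^-(x,y)=0$ if $x=y$ and $-\infty$ if $x\ne y$. A max-plus linear max-plus integral operator here is an operator of the form $\psi\mapsto\int^\oplus_{\mathbb{R}^n}F(\cdot,y)\otimes\psi(y)\,dy$ with kernel $F:\mathbb{R}^n\times\mathbb{R}^n\to\mathbb{R}^-$. For symmetric $P_0\in\mathbb{S}^{n\times n}$, the maximal horizon of existence of the solution of $\dot P_t=A'P_t+P_tA+P_tBB'P_t+C'C$ initialized at $P_0$ is $$t^*(P_0)\doteq\sup\{t>0:\ \Sigma_s^{11}+\Sigma_s^{12}P_0\text{ is invertible for all }s\in(0,t]\},$$ where $\Sigma_t\doteq\exp(\mathcal{H}t)\in\mathbb{R}^{2n\times 2n}$, $\mathcal{H}\doteq\begin{bmatrix}-A&-BB'\\ C'C&A'\end{bmatrix}$, with $n\times n$ blocks $\Sigma_t^{ij}$. Dynamic programming evolution operator: for $\psi:\mathbb{R}^n\to\mathbb{R}^-$, $$(\mathcal{S}_t\,\psi)(x)\doteq\sup_{w\in L_2([0,t];\mathbb{R}^m)}\left\{\int_0^t\tfrac12|y_s|^2-\tfrac12|w_s|^2\,ds+\psi(x_t)\right\},$$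 where $\dot x_s=Ax_s+Bw_s$, $x_0=x$, $y_s=Cx_s$; $\mathrm{dom}(\mathcal{S}_t)\doteq\{\psi:\mathbb{R}^n\to\mathbb{R}^-\ :\ (\mathcal{S}_t\psi)(x)\in\mathbb{R}^-\ \forall x\in\mathbb{R}^n\}$. Basis function: $\varphi(x,z)\doteq\tfrac12(x-z)'M(x-z)$, $x,z\in\mathbb{R}^n$. Auxiliary value function: $S_t(x,z)\doteq(\mathcal{S}_t\,\varphi(\cdot,z))(x)$. Semiconvex transform: $(\mathcal{D}_\varphi\psi)(z)\doteq-\int^\oplus_{\mathbb{R}^n}\varphi(x,z)\otimes(-\psi(x))\,dx=-\sup_{x\in\mathbb{R}^n}\{\varphi(x,z)-\psi(x)\}$, defined for $\psi:\mathbb{R}^n\to\mathbb{R}^-$ such that $x\mapsto\psi(x)-\tfrac12x'Mx$ is convex. *)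

theory Defs
  imports "HOL-Analysis.Analysis"
begin

text \<open>Functions with values in \<open>\<real> \<union> {-\<infinity>}\<close> are rendered as functions into \<^typ>\<open>ereal\<close> that
  never take the value \<open>\<infinity>\<close>, so that max-plus addition is \<^const>\<open>sup\<close>, max-plus multiplication
  is \<open>+\<close>, and the max-plus integral is a supremum.\<close>

definition Rminus_valued :: "('a \<Rightarrow> ereal) \<Rightarrow> bool" where
  "Rminus_valued \<psi> \<longleftrightarrow> (\<forall>x. \<psi> x \<noteq> \<infinity>)"

definition maxplus_delta :: "'a \<Rightarrow> 'a \<Rightarrow> ereal" where
  "maxplus_delta x y = (if x = y then 0 else -\<infinity>)"

definition maxplus_integral_op :: "('a \<Rightarrow> 'a \<Rightarrow> ereal) \<Rightarrow> ('a \<Rightarrow> ereal) \<Rightarrow> 'a \<Rightarrow> ereal" where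
  "maxplus_integral_op F \<psi> = (\<lambda>x. SUP y. F x y + \<psi> y)"

definition is_maxplus_integral_op ::
    "(('a \<Rightarrow> ereal) \<Rightarrow> 'a \<Rightarrow> ereal) \<Rightarrow> ('a \<Rightarrow> 'a \<Rightarrow> ereal) \<Rightarrow> bool" where
  "is_maxplus_integral_op T F \<longleftrightarrow>
     (\<forall>x. Rminus_valued (F x)) \<and> (\<forall>\<psi>. Rminus_valued \<psi> \<longrightarrow> T \<psi> = maxplus_integral_op F \<psi>)"

definition op_dom :: "(('a \<Rightarrow> ereal) \<Rightarrow> 'a \<Rightarrow> ereal) \<Rightarrow> ('a \<Rightarrow> ereal) set" where
  "op_dom T = {\<psi>. Rminus_valued \<psi> \<and> Rminus_valued (T \<psi>)}"

text \<open>The library has no exponential for the matrix type, hence the power series.\<close>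

definition matrix_exp :: "real^'k^'k \<Rightarrow> real^'k^'k" where
  "matrix_exp X = (\<Sum>k. (1 / fact k) *\<^sub>R (((\<lambda>Y. X ** Y) ^^ k) (mat 1)))"

definition hamiltonian ::
    "real^'n^'n \<Rightarrow> real^'m^'n \<Rightarrow> real^'n^'p \<Rightarrow> real^('n + 'n)^('n + 'n)" where
  "hamiltonian A B C = (\<chi> i j. case (i, j) of
      (Inl k, Inl l) \<Rightarrow> - A $ k $ l
    | (Inl k, Inr l) \<Rightarrow> - (B ** transpose B) $ k $ l
    | (Inr k, Inl l) \<Rightarrow> (transpose C ** C) $ k $ l
    | (Inr k, Inr l) \<Rightarrow> transpose A $ k $ l)"

definition symplectic_flow ::
    "real^'n^'n \<Rightarrow> real^'m^'n \<Rightarrow> real^'n^'p \<Rightarrow> real \<Rightarrow> real^('n + 'n)^('n + 'n)" where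
  "symplectic_flow A B C t = matrix_exp (t *\<^sub>R hamiltonian A B C)"

definition block11 :: "real^('n + 'n)^('n + 'n) \<Rightarrow> real^'n^'n" where
  "block11 X = (\<chi> i j. X $ Inl i $ Inl j)"

definition block12 :: "real^('n + 'n)^('n + 'n) \<Rightarrow> real^'n^'n" where
  "block12 X = (\<chi> i j. X $ Inl i $ Inr j)"

definition max_horizon ::
    "real^'n^'n \<Rightarrow> real^'m^'n \<Rightarrow> real^'n^'p \<Rightarrow> real^'n^'n \<Rightarrow> ereal" where
  "max_horizon A B C P0 = Sup (ereal ` {t. t > 0 \<and>
     (\<forall>s\<in>{0<..t}. invertible (block11 (symplectic_flow A B C s)
                              + block12 (symplectic_flow A B C s) ** P0))})"

definition L2_on :: "real \<Rightarrow> (real \<Rightarrow> real^'m) set" where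
  "L2_on t = {w. set_borel_measurable lebesgue {0..t} w \<and>
                 set_integrable lebesgue {0..t} (\<lambda>s. (norm (w s))\<^sup>2)}"

text \<open>For an \<open>L\<^sub>2\<close> input the differential equation holds almost everywhere with an absolutely
  continuous state; this is the equivalent integrated (Caratheodory) form.\<close>

definition state_trajectory ::
    "real^'n^'n \<Rightarrow> real^'m^'n \<Rightarrow> real \<Rightarrow> real^'n \<Rightarrow> (real \<Rightarrow> real^'m) \<Rightarrow> (real \<Rightarrow> real^'n) \<Rightarrow> bool"
  where
  "state_trajectory A B t x0 w x \<longleftrightarrow> continuous_on {0..t} x \<and>
     (\<forall>s\<in>{0..t}. x s = x0 + (LINT r:{0..s}|lebesgue. A *v x r + B *v w r))"

definition running_payoff ::
    "real^'n^'p \<Rightarrow> real \<Rightarrow> (real \<Rightarrow> real^'m) \<Rightarrow> (real \<Rightarrow> real^'n) \<Rightarrow> real" where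
  "running_payoff C t w x =
     (LINT s:{0..t}|lebesgue. 1/2 * (norm (C *v x s))\<^sup>2 - 1/2 * (norm (w s))\<^sup>2)"

text \<open>Every \<open>w\<close> determines its trajectory uniquely on \<open>[0, t]\<close>, so the supremum over pairs of an
  input and its trajectory is the supremum over inputs.\<close>

definition dp_evolution ::
    "real^'n^'n \<Rightarrow> real^'m^'n \<Rightarrow> real^'n^'p \<Rightarrow> real \<Rightarrow> (real^'n \<Rightarrow> ereal) \<Rightarrow> real^'n \<Rightarrow> ereal" where
  "dp_evolution A B C t \<psi> = (\<lambda>x0.
     SUP (w, x) \<in> {(w, x). w \<in> L2_on t \<and> state_trajectory A B t x0 w x}.
       ereal (running_payoff C t w x) + \<psi> (x t))"

definition basis_fun :: "real^'n^'n \<Rightarrow> real^'n \<Rightarrow> real^'n \<Rightarrow> real" where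
  "basis_fun M x z = 1/2 * ((x - z) \<bullet> (M *v (x - z)))"

definition aux_value ::
    "real^'n^'n \<Rightarrow> real^'m^'n \<Rightarrow> real^'n^'p \<Rightarrow> real^'n^'n \<Rightarrow> real \<Rightarrow> real^'n \<Rightarrow> real^'n \<Rightarrow> ereal" where
  "aux_value A B C M t x z = dp_evolution A B C t (\<lambda>\<xi>. ereal (basis_fun M \<xi> z)) x"

definition Rminus_convex :: "('a::real_vector \<Rightarrow> ereal) \<Rightarrow> bool" where
  "Rminus_convex f \<longleftrightarrow> (\<forall>x y. \<forall>u\<in>{0<..<1}.
     f ((1 - u) *\<^sub>R x + u *\<^sub>R y) \<le> ereal (1 - u) * f x + ereal u * f y)"

definition semiconvex_transform_dom :: "real^'n^'n \<Rightarrow> (real^'n \<Rightarrow> ereal) set" where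
  "semiconvex_transform_dom M = {\<psi>. Rminus_valued \<psi> \<and>
     Rminus_convex (\<lambda>x. \<psi> x - ereal (1/2 * (x \<bullet> (M *v x))))}"

definition semiconvex_transform ::
    "real^'n^'n \<Rightarrow> (real^'n \<Rightarrow> ereal) \<Rightarrow> real^'n \<Rightarrow> ereal" where
  "semiconvex_transform M \<psi> z = - (SUP x. ereal (basis_fun M x z) + (- \<psi> x))"

end

theory Submission
  imports Defs
begin

text \<open>The kernel \<open>G\<^sub>t(x, y)\<close> is the best payoff among trajectories from \<open>x\<close> to \<open>y\<close>. Grouping the
  trajectories from \<open>x\<close> by their endpoints gives \<open>S\<^sub>t \<psi> = G\<^sub>t \<psi>\<close>
  (\<open>dp_evolution_eq_maxplus_integral\<close>), provided that \<open>G\<^sub>t\<close> does not take the value \<open>\<infinity>\<close>.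
  What remains is the duality \<open>G\<^sub>t(x, y) = inf\<^sub>z (S\<^sub>t(x, z) - \<phi>(y, z))\<close>, which says that
  \<open>y \<mapsto> G\<^sub>t(x, y) + 1/2 * (y \<bullet> (M *v y))\<close>, a concave quadratic function on an affine subspace
  and \<open>- \<infinity>\<close> outside it, is recovered from its conjugate.

  The duality is proved with the characteristics of the control problem, the state and costate
  pairs \<open>(x, p)\<close> solving the Hamiltonian system. The horizon condition provides a Riccati solution
  \<open>P\<close> on all of \<open>[0, t]\<close> with \<open>P t = M\<close> (\<open>riccati_solution\<close>). Completing the square with \<open>P\<close>, along
  states that are merely absolutely continuous, shows that a characteristic with terminal costate
  \<open>p t = M (x t - z)\<close> attains the supremum that defines \<open>S\<^sub>t(x, z)\<close>
  (\<open>hamiltonian_pair_optimal\<close>). Hence \<open>S\<^sub>t(x, z)\<close> is finite and equals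
  \<open>1/2 * (x \<bullet> p 0 - z \<bullet> p t)\<close> (\<open>aux_value_eq\<close>).

  Now fix \<open>x\<close> and \<open>y\<close>. A characteristic from \<open>x\<close> to \<open>y\<close>, if there is one, is optimal for some
  \<open>S\<^sub>t(x, z)\<close>, because \<open>M\<close> is invertible, and the infimum is attained there. The endpoints of
  characteristics from \<open>x\<close> form a translate of the range of a matrix \<open>W\<close>, which is symmetric because
  the Wronskian of two characteristics is constant (\<open>wronskian_constant\<close>). If \<open>y\<close> is not among
  them, some kernel vector \<open>u\<close> of \<open>W\<close> is not orthogonal to the displacement, and on the line
  \<open>M z = c u\<close> the function \<open>S\<^sub>t(x, z) - \<phi>(y, z)\<close> is affine and not constant, so the infimum is \<open>- \<infinity>\<close>
  (\<open>delta_evolution_eq_semiconvex_transform\<close>).\<close>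

section \<open>Matrix calculus and the matrix exponential\<close>

lemma bounded_bilinear_matrix_mult:
  "bounded_bilinear ((**) :: real^'k^'m \<Rightarrow> real^'l^'k \<Rightarrow> real^'l^'m)"
  unfolding bilinear_conv_bounded_bilinear[symmetric] bilinear_def
  by (auto intro!: linearI simp: matrix_add_ldistrib scalar_matrix_assoc matrix_scalar_ac)
    (simp add: matrix_matrix_mult_def vec_eq_iff sum.distrib distrib_right)

lemma bounded_bilinear_matrix_vector_mult:
  "bounded_bilinear ((*v) :: real^'k^'m \<Rightarrow> real^'k \<Rightarrow> real^'m)"
  unfolding bilinear_conv_bounded_bilinear[symmetric] bilinear_def
  by (auto intro!: linearI simp: matrix_vector_mult_add_rdistrib matrix_vector_right_distrib
      scaleR_matrix_vector_assoc matrix_vector_mult_scaleR)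

lemma continuous_on_matrix_vector_mult:
  fixes X :: "'a::topological_space \<Rightarrow> real^'k^'l"
  shows "continuous_on T X \<Longrightarrow> continuous_on T y \<Longrightarrow> continuous_on T (\<lambda>s. X s *v y s)"
  by (rule bounded_bilinear.continuous_on[OF bounded_bilinear_matrix_vector_mult])

lemma inner_matrix_vector_transpose: "(x::real^'m) \<bullet> ((A::real^'n^'m) *v y) = (transpose A *v x) \<bullet> y"
  by (simp add: dot_lmul_matrix)

lemma has_vector_derivative_matrix_componentwise:
  fixes f :: "real \<Rightarrow> real^'k^'l"
  assumes "\<And>i j. ((\<lambda>s. f s $ i $ j) has_real_derivative f' $ i $ j) (at s)"
  shows "(f has_vector_derivative f') (at s)"
  unfolding has_vector_derivative_def
proof (subst has_derivative_componentwise_within, intro ballI)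
  fix e :: "real^'k^'l"
  assume "e \<in> Basis"
  then obtain i j where e: "e = axis i (axis j 1)"
    by (auto simp: Basis_vec_def)
  have "((\<lambda>s. f s $ i $ j) has_derivative (\<lambda>h. h * f' $ i $ j)) (at s)"
    using assms[of i j] by (rule has_field_derivative_imp_has_derivative[THEN has_derivative_eq_rhs])
      (simp add: fun_eq_iff)
  then show "((\<lambda>s. f s \<bullet> e) has_derivative (\<lambda>h. h *\<^sub>R f' \<bullet> e)) (at s)"
    by (simp add: e inner_axis)
qed

abbreviation matrix_power :: "real^'k^'k \<Rightarrow> nat \<Rightarrow> real^'k^'k" where
  "matrix_power X k \<equiv> ((\<lambda>Y. X ** Y) ^^ k) (mat 1)"

lemma matrix_power_scaleR: "matrix_power (s *\<^sub>R X) k = s ^ k *\<^sub>R matrix_power X k"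
  by (induction k) (auto simp: matrix_scalar_ac scalar_matrix_assoc[symmetric] mult.commute)

lemma matrix_power_bound:
  fixes X :: "real^'k^'k"
  obtains K where "\<And>k. norm (matrix_power X k) \<le> K ^ k * norm (mat 1 :: real^'k^'k)"
proof -
  obtain K where K: "\<And>(a :: real^'k^'k) (b :: real^'k^'k). norm (a ** b) \<le> norm a * norm b * K" and "K > 0"
    using bounded_bilinear.pos_bounded[OF bounded_bilinear_matrix_mult] by blast
  have "norm (matrix_power X k) \<le> (norm X * K) ^ k * norm (mat 1 :: real^'k^'k)" for k
  proof (induction k)
    case (Suc k)
    have "norm (matrix_power X (Suc k)) \<le> (norm X * K) * norm (matrix_power X k)"
      using K[of X "matrix_power X k"] by (simp add: mult_ac)
    also have "\<dots> \<le> (norm X * K) * ((norm X * K) ^ k * norm (mat 1 :: real^'k^'k))"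
      using Suc \<open>K > 0\<close> by (intro mult_left_mono) auto
    finally show ?case by (simp add: mult_ac)
  qed auto
  then show ?thesis using that by blast
qed

lemma summable_matrix_exp: "summable (\<lambda>k. (1 / fact k) *\<^sub>R matrix_power X k)"
proof -
  obtain K where K: "\<And>k. norm (matrix_power X k) \<le> K ^ k * norm (mat 1 :: real^'a^'a)"
    using matrix_power_bound[of X] by blast
  have "summable (\<lambda>k. (inverse (fact k) * K ^ k) * norm (mat 1 :: real^'a^'a))"
    by (intro summable_mult2 summable_exp)
  then show ?thesis
    by (rule summable_comparison_test')
      (use K in \<open>simp add: divide_simps mult.commute\<close>)
qed

lemma matrix_exp_nth:
  "matrix_exp (s *\<^sub>R X) $ i $ j = (\<Sum>k. (matrix_power X k $ i $ j / fact k) * s ^ k)"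
proof -
  have bl: "bounded_linear (\<lambda>Y::real^'a^'a. Y $ i $ j)"
    by (intro bounded_linear_compose[OF bounded_linear_vec_nth] bounded_linear_vec_nth)
  show ?thesis
    unfolding matrix_exp_def
    by (subst bounded_linear.suminf[OF bl summable_matrix_exp])
      (simp add: matrix_power_scaleR mult_ac)
qed

lemma summable_matrix_exp_nth:
  "summable (\<lambda>k. (matrix_power X k $ i $ j / fact k) * s ^ k)"
proof -
  have bl: "bounded_linear (\<lambda>Y::real^'a^'a. Y $ i $ j)"
    by (intro bounded_linear_compose[OF bounded_linear_vec_nth] bounded_linear_vec_nth)
  show ?thesis
    using bounded_linear.summable[OF bl summable_matrix_exp[of "s *\<^sub>R X"]]
    by (simp add: matrix_power_scaleR mult_ac)
qed

text \<open>The derivative of the matrix exponential is computed entrywise: each entry is an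
  everywhere convergent scalar power series, which may be differentiated termwise.\<close>

lemma matrix_exp_has_vector_derivative:
  "((\<lambda>s. matrix_exp (s *\<^sub>R X)) has_vector_derivative X ** matrix_exp (s *\<^sub>R X)) (at s)"
proof (rule has_vector_derivative_matrix_componentwise)
  fix i j
  have "(\<Sum>k. diffs (\<lambda>k. matrix_power X k $ i $ j / fact k) k * s ^ k)
      = (\<Sum>k. \<Sum>l\<in>UNIV. X $ i $ l * ((matrix_power X k $ l $ j / fact k) * s ^ k))"
  proof (intro suminf_cong)
    fix k
    have "diffs (\<lambda>k. matrix_power X k $ i $ j / fact k) k * s ^ k
        = (X ** matrix_power X k) $ i $ j / fact k * s ^ k"
      by (simp add: diffs_def del: of_nat_Suc)
    also have "\<dots> = (\<Sum>l\<in>UNIV. X $ i $ l * ((matrix_power X k $ l $ j / fact k) * s ^ k))"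
      unfolding matrix_matrix_mult_def[of X "matrix_power X k"]
      by (simp only: vec_lambda_beta sum_divide_distrib sum_distrib_right times_divide_eq_left
          times_divide_eq_right mult.assoc)
    finally show "diffs (\<lambda>k. matrix_power X k $ i $ j / fact k) k * s ^ k
        = (\<Sum>l\<in>UNIV. X $ i $ l * ((matrix_power X k $ l $ j / fact k) * s ^ k))" .
  qed
  also have "\<dots> = (\<Sum>l\<in>UNIV. \<Sum>k. X $ i $ l * ((matrix_power X k $ l $ j / fact k) * s ^ k))"
    by (intro suminf_sum summable_mult summable_matrix_exp_nth)
  also have "\<dots> = (X ** matrix_exp (s *\<^sub>R X)) $ i $ j"
    unfolding matrix_matrix_mult_def[of X "matrix_exp (s *\<^sub>R X)"]
    by (simp only: vec_lambda_beta matrix_exp_nth suminf_mult[OF summable_matrix_exp_nth])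
  finally show "((\<lambda>s. matrix_exp (s *\<^sub>R X) $ i $ j) has_real_derivative
      (X ** matrix_exp (s *\<^sub>R X)) $ i $ j) (at s)"
    using termdiffs_strong_converges_everywhere[OF summable_matrix_exp_nth, of X i j s]
    by (simp add: matrix_exp_nth)
qed

lemma matrix_exp_0: "matrix_exp 0 = mat 1"
proof -
  have "matrix_exp (0 *\<^sub>R 0 :: real^'a^'a) $ i $ j = (mat 1 :: real^'a^'a) $ i $ j" for i j
    unfolding matrix_exp_nth by (subst powser_zero) simp
  then show ?thesis by (simp add: vec_eq_iff)
qed

section \<open>The Hamiltonian system\<close>

definition block21 :: "real^('n + 'n)^('n + 'n) \<Rightarrow> real^'n^'n" where
  "block21 X = (\<chi> i j. X $ Inr i $ Inl j)"

definition block22 :: "real^('n + 'n)^('n + 'n) \<Rightarrow> real^'n^'n" where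
  "block22 X = (\<chi> i j. X $ Inr i $ Inr j)"

lemmas block_defs = block11_def block12_def block21_def block22_def

lemma bounded_linear_blocks:
  "bounded_linear block11" "bounded_linear block12" "bounded_linear block21" "bounded_linear block22"
  by (auto intro!: linear_conv_bounded_linear[THEN iffD1] linearI simp: block_defs vec_eq_iff)

lemma blocks_mat_1:
  "block11 (mat 1) = mat 1" "block12 (mat 1) = 0" "block21 (mat 1) = 0" "block22 (mat 1) = mat 1"
  by (auto simp: block_defs mat_def vec_eq_iff)

lemma sum_UNIV_sum_type:
  fixes f :: "'a::finite + 'b::finite \<Rightarrow> 'c::comm_monoid_add"
  shows "sum f UNIV = (\<Sum>i\<in>UNIV. f (Inl i)) + (\<Sum>i\<in>UNIV. f (Inr i))"
  unfolding UNIV_Plus_UNIV[symmetric] by (subst sum.Plus) simp_all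

lemma blocks_matrix_mult:
  "block11 (X ** Y) = block11 X ** block11 Y + block12 X ** block21 Y"
  "block12 (X ** Y) = block11 X ** block12 Y + block12 X ** block22 Y"
  "block21 (X ** Y) = block21 X ** block11 Y + block22 X ** block21 Y"
  "block22 (X ** Y) = block21 X ** block12 Y + block22 X ** block22 Y"
  by (simp_all add: block_defs matrix_matrix_mult_def vec_eq_iff sum_UNIV_sum_type)

lemma blocks_hamiltonian:
  "block11 (hamiltonian A B C) = - A" "block12 (hamiltonian A B C) = - (B ** transpose B)"
  "block21 (hamiltonian A B C) = transpose C ** C" "block22 (hamiltonian A B C) = transpose A"
  by (auto simp: block_defs hamiltonian_def vec_eq_iff)

lemma symplectic_flow_0: "symplectic_flow A B C 0 = mat 1"
  by (simp add: symplectic_flow_def matrix_exp_0)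

lemma blocks_flow_has_vector_derivative:
  fixes A :: "real^'n^'n" and B :: "real^'m^'n" and C :: "real^'n^'p"
  defines "S \<equiv> symplectic_flow A B C"
  shows
  "((\<lambda>s. block11 (S s)) has_vector_derivative
      - (A ** block11 (S s)) - (B ** transpose B) ** block21 (S s)) (at s)"
  "((\<lambda>s. block12 (S s)) has_vector_derivative
      - (A ** block12 (S s)) - (B ** transpose B) ** block22 (S s)) (at s)"
  "((\<lambda>s. block21 (S s)) has_vector_derivative
      (transpose C ** C) ** block11 (S s) + transpose A ** block21 (S s)) (at s)"
  "((\<lambda>s. block22 (S s)) has_vector_derivative
      (transpose C ** C) ** block12 (S s) + transpose A ** block22 (S s)) (at s)"
proof -
  have D: "(S has_vector_derivative hamiltonian A B C ** S s) (at s)"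
    unfolding S_def symplectic_flow_def[abs_def] by (rule matrix_exp_has_vector_derivative)
  have neg: "- K ** L = - (K ** L)" for K L :: "real^'n^'n"
    by (simp add: matrix_matrix_mult_def vec_eq_iff sum_negf)
  show "((\<lambda>s. block11 (S s)) has_vector_derivative
      - (A ** block11 (S s)) - (B ** transpose B) ** block21 (S s)) (at s)"
    using bounded_linear.has_vector_derivative[OF bounded_linear_blocks(1) D]
    by (simp add: blocks_matrix_mult blocks_hamiltonian neg)
  show "((\<lambda>s. block12 (S s)) has_vector_derivative
      - (A ** block12 (S s)) - (B ** transpose B) ** block22 (S s)) (at s)"
    using bounded_linear.has_vector_derivative[OF bounded_linear_blocks(2) D]
    by (simp add: blocks_matrix_mult blocks_hamiltonian neg)
  show "((\<lambda>s. block21 (S s)) has_vector_derivative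
      (transpose C ** C) ** block11 (S s) + transpose A ** block21 (S s)) (at s)"
    using bounded_linear.has_vector_derivative[OF bounded_linear_blocks(3) D]
    by (simp add: blocks_matrix_mult blocks_hamiltonian)
  show "((\<lambda>s. block22 (S s)) has_vector_derivative
      (transpose C ** C) ** block12 (S s) + transpose A ** block22 (S s)) (at s)"
    using bounded_linear.has_vector_derivative[OF bounded_linear_blocks(4) D]
    by (simp add: blocks_matrix_mult blocks_hamiltonian)
qed

lemma matrix_vector_mult_minus_left: "(- K) *v b = - ((K :: real^'k^'l) *v b)"
  by (simp add: matrix_vector_mult_def vec_eq_iff sum_negf)

text \<open>The characteristics of the control problem: a state and its costate, coupled by the
  maximising input \<open>transpose B *v p s\<close>. The matrix \<open>hamiltonian A B C\<close> generates the same
  system with time reversed, so its flow \<open>symplectic_flow A B C s\<close> carries a terminal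
  state and costate back by \<open>s\<close> units of time.\<close>

definition hamiltonian_pair ::
    "real^'n^'n \<Rightarrow> real^'m^'n \<Rightarrow> real^'n^'p \<Rightarrow> (real \<Rightarrow> real^'n) \<Rightarrow> (real \<Rightarrow> real^'n) \<Rightarrow> bool"
  where
  "hamiltonian_pair A B C x p \<longleftrightarrow> (\<forall>s.
     (x has_vector_derivative A *v x s + B *v (transpose B *v p s)) (at s) \<and>
     (p has_vector_derivative - (transpose C *v (C *v x s)) - transpose A *v p s) (at s))"

lemma hamiltonian_pair_with_terminal:
  fixes A :: "real^'n^'n" and B :: "real^'m^'n" and C :: "real^'n^'p"
  obtains x p where "hamiltonian_pair A B C x p" "x t = y" "p t = l"
    "x 0 = block11 (symplectic_flow A B C t) *v y + block12 (symplectic_flow A B C t) *v l"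
proof -
  let ?S = "symplectic_flow A B C"
  define x where "x = (\<lambda>s. block11 (?S (t - s)) *v y + block12 (?S (t - s)) *v l)"
  define p where "p = (\<lambda>s. block21 (?S (t - s)) *v y + block22 (?S (t - s)) *v l)"
  have r: "((\<lambda>s. t - s) has_vector_derivative -1) (at s)" for s :: real
    by (auto intro!: derivative_eq_intros)
  have D: "((\<lambda>s. f (?S (t - s)) *v b) has_vector_derivative - (f' *v b)) (at s)"
    if "((\<lambda>s. f (?S s)) has_vector_derivative f') (at (t - s))"
    for f :: "real^('n + 'n)^('n + 'n) \<Rightarrow> real^'n^'n" and f' s b
  proof -
    have "(((\<lambda>s. f (?S s)) \<circ> (\<lambda>s. t - s)) has_vector_derivative (-1) *\<^sub>R f') (at s)"
      using that by (intro vector_diff_chain_at r)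
    then have "((\<lambda>s. f (?S (t - s))) has_vector_derivative - f') (at s)"
      by (simp add: o_def)
    from bounded_bilinear.has_vector_derivative[OF bounded_bilinear_matrix_vector_mult
        this has_vector_derivative_const[of b]]
    show ?thesis by (simp add: matrix_vector_mult_minus_left)
  qed
  have "hamiltonian_pair A B C x p"
    unfolding hamiltonian_pair_def
  proof (intro allI conjI)
    fix s
    note B = blocks_flow_has_vector_derivative[of A B C "t - s"]
    show "(x has_vector_derivative A *v x s + B *v (transpose B *v p s)) (at s)"
      unfolding x_def
      by (rule has_vector_derivative_eq_rhs[OF has_vector_derivative_add[OF D[OF B(1)] D[OF B(2)]]])
        (simp add: p_def algebra_simps matrix_vector_mult_minus_left matrix_vector_mul_assoc matrix_mul_assoc
           matrix_vector_mult_add_rdistrib)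
    show "(p has_vector_derivative - (transpose C *v (C *v x s)) - transpose A *v p s) (at s)"
      unfolding p_def
      by (rule has_vector_derivative_eq_rhs[OF has_vector_derivative_add[OF D[OF B(3)] D[OF B(4)]]])
        (simp add: x_def algebra_simps matrix_vector_mul_assoc matrix_mul_assoc)
  qed
  moreover have "x t = y" "p t = l"
    by (simp_all add: x_def p_def symplectic_flow_0 blocks_mat_1)
  ultimately show ?thesis using that by (simp add: x_def)
qed

lemma hamiltonian_pair_lincomb:
  assumes "hamiltonian_pair A B C x p" "hamiltonian_pair A B C x' p'"
  shows "hamiltonian_pair A B C (\<lambda>s. x s + c *\<^sub>R x' s) (\<lambda>s. p s + c *\<^sub>R p' s)"
  unfolding hamiltonian_pair_def
proof (intro allI conjI)
  fix s
  have a: "(x has_vector_derivative A *v x s + B *v (transpose B *v p s)) (at s)"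
    "(p has_vector_derivative - (transpose C *v (C *v x s)) - transpose A *v p s) (at s)"
    "(x' has_vector_derivative A *v x' s + B *v (transpose B *v p' s)) (at s)"
    "(p' has_vector_derivative - (transpose C *v (C *v x' s)) - transpose A *v p' s) (at s)"
    using assms unfolding hamiltonian_pair_def by blast+
  note sc = bounded_linear.has_vector_derivative[OF bounded_linear_scaleR_right]
  show "((\<lambda>s. x s + c *\<^sub>R x' s) has_vector_derivative
      A *v (x s + c *\<^sub>R x' s) + B *v (transpose B *v (p s + c *\<^sub>R p' s))) (at s)"
    by (rule has_vector_derivative_eq_rhs[OF has_vector_derivative_add[OF a(1) sc[OF a(3)]]])
      (simp add: matrix_vector_right_distrib matrix_vector_mult_scaleR scaleR_add_right)
  show "((\<lambda>s. p s + c *\<^sub>R p' s) has_vector_derivative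
      - (transpose C *v (C *v (x s + c *\<^sub>R x' s))) - transpose A *v (p s + c *\<^sub>R p' s)) (at s)"
    by (rule has_vector_derivative_eq_rhs[OF has_vector_derivative_add[OF a(2) sc[OF a(4)]]])
      (simp add: matrix_vector_right_distrib matrix_vector_mult_scaleR scaleR_diff_right)
qed

text \<open>The flow is symplectic. This invariance is the only form of symplecticity that the argument needs:
  it yields the symmetry of the Riccati solution and of the endpoint matrix, and it evaluates the
  payoff along degenerate directions.\<close>

lemma wronskian_constant:
  assumes "hamiltonian_pair A B C x p" "hamiltonian_pair A B C x' p'"
  shows "x s \<bullet> p' s - x' s \<bullet> p s = x r \<bullet> p' r - x' r \<bullet> p r"
proof -
  note bb = bounded_bilinear.has_vector_derivative[OF bounded_bilinear_inner]
  have "((\<lambda>s. x s \<bullet> p' s - x' s \<bullet> p s) has_vector_derivative 0) (at s)" for s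
  proof -
    have a: "(x has_vector_derivative A *v x s + B *v (transpose B *v p s)) (at s)"
      "(p has_vector_derivative - (transpose C *v (C *v x s)) - transpose A *v p s) (at s)"
      "(x' has_vector_derivative A *v x' s + B *v (transpose B *v p' s)) (at s)"
      "(p' has_vector_derivative - (transpose C *v (C *v x' s)) - transpose A *v p' s) (at s)"
      using assms unfolding hamiltonian_pair_def by blast+
    have adjC: "a \<bullet> (transpose C *v b) = (C *v a) \<bullet> b" for a b
      by (metis inner_matrix_vector_transpose transpose_transpose)
    have adjA: "a \<bullet> (transpose A *v b) = (A *v a) \<bullet> b" for a b
      by (metis inner_matrix_vector_transpose transpose_transpose)
    have adjB: "b \<bullet> (B *v a) = a \<bullet> (transpose B *v b)" for a b
      by (metis inner_matrix_vector_transpose inner_commute)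
    show ?thesis
      by (rule has_vector_derivative_eq_rhs[OF has_vector_derivative_diff[OF bb[OF a(1) a(4)] bb[OF a(3) a(2)]]])
        (simp add: inner_add_left inner_add_right inner_diff_right adjA adjB adjC inner_commute
          del: transpose_matrix_vector)
  qed
  then obtain c where "\<And>r. x r \<bullet> p' r - x' r \<bullet> p r = c"
    using has_vector_derivative_zero_constant[of UNIV "\<lambda>s. x s \<bullet> p' s - x' s \<bullet> p s"]
    by (metis UNIV_I convex_UNIV)
  then show ?thesis by metis
qed

section \<open>The Riccati equation\<close>

lemma matrix_inv_cancel:
  fixes X :: "real^'k^'k"
  assumes "invertible X"
  shows "X ** matrix_inv X = mat 1" "matrix_inv X ** X = mat 1"
  using someI_ex[OF assms[unfolded invertible_def]] unfolding matrix_inv_def by auto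

lemma continuous_on_det:
  fixes X :: "'a::topological_space \<Rightarrow> real^'k^'k"
  shows "continuous_on T X \<Longrightarrow> continuous_on T (\<lambda>s. det (X s))"
  unfolding det_def by (intro continuous_intros)

text \<open>By Cramer's rule the entries of the inverse are quotients of determinants.\<close>

lemma continuous_on_matrix_inv:
  fixes X :: "'a::topological_space \<Rightarrow> real^'k^'k"
  assumes X: "continuous_on T X" and inv: "\<And>s. s \<in> T \<Longrightarrow> invertible (X s)"
  shows "continuous_on T (\<lambda>s. matrix_inv (X s))"
proof -
  define N where "N s k j = det (\<chi> i l. if l = k then axis j 1 $ i else X s $ i $ l)" for s and k j :: 'k
  have "matrix_inv (X s) = (\<chi> k j. N s k j / det (X s))" if "s \<in> T" for s
  proof -
    have d: "det (X s) \<noteq> 0" using inv[OF that] by (simp add: invertible_det_nz)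
    have "matrix_inv (X s) $ k $ j = N s k j / det (X s)" for k j
    proof -
      have "X s *v (matrix_inv (X s) *v axis j 1) = axis j 1"
        by (simp add: matrix_vector_mul_assoc matrix_inv_cancel inv[OF that])
      then have "(matrix_inv (X s) *v axis j 1) $ k = N s k j / det (X s)"
        unfolding cramer[OF d] by (simp add: N_def)
      then show ?thesis by (simp add: matrix_vector_mul_component inner_axis)
    qed
    then show ?thesis by (simp add: vec_eq_iff)
  qed
  moreover have "continuous_on T (\<lambda>s. \<chi> k j. N s k j / det (X s))"
  proof (intro continuous_on_vec_lambda continuous_on_divide continuous_on_det X)
    fix k j
    have "continuous_on T (\<lambda>s. if l = k then axis j 1 $ i else X s $ i $ l)" for i l
      by (cases "l = k") (auto intro!: continuous_intros X)
    then show "continuous_on T (\<lambda>s. N s k j)"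
      unfolding N_def by (intro continuous_on_det continuous_on_vec_lambda)
    show "\<forall>s\<in>T. det (X s) \<noteq> 0" using inv by (simp add: invertible_det_nz)
  qed
  ultimately show ?thesis by (simp cong: continuous_on_cong)
qed

text \<open>Writing \<open>Z\<close> for the inverse, \<open>Z r - Z s = Z r ** (X s - X r) ** Z s\<close>. The difference quotient of
  \<open>Z\<close> is thus that of \<open>X\<close> between two factors that converge.\<close>

lemma matrix_inv_has_vector_derivative:
  fixes X :: "real \<Rightarrow> real^'k^'k"
  assumes X: "(X has_vector_derivative X') (at s within T)" and s: "s \<in> T"
    and cont: "continuous_on T X" and inv: "\<And>s. s \<in> T \<Longrightarrow> invertible (X s)"
  shows "((\<lambda>s. matrix_inv (X s)) has_vector_derivative
    - (matrix_inv (X s) ** X' ** matrix_inv (X s))) (at s within T)"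
proof -
  let ?Z = "\<lambda>s. matrix_inv (X s)"
  interpret mm: bounded_bilinear "(**) :: real^'k^'k \<Rightarrow> real^'k^'k \<Rightarrow> real^'k^'k"
    by (rule bounded_bilinear_matrix_mult)
  have Zlim: "(?Z \<longlongrightarrow> ?Z s) (at s within T)"
    using continuous_on_matrix_inv[OF cont inv] s unfolding continuous_on_def by blast
  have "((\<lambda>r. (1 / norm (r - s)) *\<^sub>R (X r - (X s + (r - s) *\<^sub>R X'))) \<longlongrightarrow> 0) (at s within T)"
    using X unfolding has_vector_derivative_def has_derivative_within by blast
  then have "((\<lambda>r. - (?Z r ** ((1 / norm (r - s)) *\<^sub>R (X r - (X s + (r - s) *\<^sub>R X'))) ** ?Z s))
      \<longlongrightarrow> - (?Z s ** 0 ** ?Z s)) (at s within T)"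
    by (intro tendsto_minus mm.tendsto tendsto_const Zlim)
  moreover have "((\<lambda>r. sgn (r - s) *\<^sub>R ((?Z s - ?Z r) ** X' ** ?Z s)) \<longlongrightarrow> 0) (at s within T)"
  proof (rule Lim_null_comparison)
    show "\<forall>\<^sub>F r in at s within T. norm (sgn (r - s) *\<^sub>R ((?Z s - ?Z r) ** X' ** ?Z s))
        \<le> norm ((?Z s - ?Z r) ** X' ** ?Z s)"
      by (intro always_eventually allI) (simp add: sgn_if)
    have "((\<lambda>r. (?Z s - ?Z r) ** X' ** ?Z s) \<longlongrightarrow> (?Z s - ?Z s) ** X' ** ?Z s) (at s within T)"
      by (intro mm.tendsto tendsto_diff tendsto_const Zlim)
    then show "((\<lambda>r. norm ((?Z s - ?Z r) ** X' ** ?Z s)) \<longlongrightarrow> 0) (at s within T)"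
      by (simp add: tendsto_norm_zero mm.zero_left)
  qed
  ultimately have lim: "((\<lambda>r. - (?Z r ** ((1 / norm (r - s)) *\<^sub>R (X r - (X s + (r - s) *\<^sub>R X'))) ** ?Z s)
      + sgn (r - s) *\<^sub>R ((?Z s - ?Z r) ** X' ** ?Z s)) \<longlongrightarrow> - (?Z s ** 0 ** ?Z s) + 0) (at s within T)"
    by (rule tendsto_add)
  have eq: "- (?Z r ** ((1 / norm (r - s)) *\<^sub>R (X r - (X s + (r - s) *\<^sub>R X'))) ** ?Z s)
      + sgn (r - s) *\<^sub>R ((?Z s - ?Z r) ** X' ** ?Z s)
    = (1 / norm (r - s)) *\<^sub>R (?Z r - (?Z s + (r - s) *\<^sub>R (- (?Z s ** X' ** ?Z s))))"
    if "r \<in> T" for r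
  proof -
    have a: "?Z r ** X r ** ?Z s = ?Z s" "?Z r ** X s ** ?Z s = ?Z r"
      using matrix_inv_cancel[OF inv[OF that]] matrix_inv_cancel[OF inv[OF s]]
      by (simp_all flip: matrix_mul_assoc)
    have sg: "sgn (r - s) = (1 / norm (r - s)) * (r - s)"
      by (auto simp: sgn_if field_simps)
    show ?thesis
      unfolding sg
      by (simp add: mm.diff_left mm.diff_right mm.add_right mm.add_left mm.scaleR_left mm.scaleR_right
          algebra_simps diff_divide_distrib a)
  qed
  have "((\<lambda>r. (1 / norm (r - s)) *\<^sub>R (?Z r - (?Z s + (r - s) *\<^sub>R (- (?Z s ** X' ** ?Z s))))) \<longlongrightarrow> 0)
      (at s within T)"
  proof (rule Lim_transform_eventually[THEN tendsto_eq_rhs, OF lim])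
    show "\<forall>\<^sub>F r in at s within T.
        - (?Z r ** ((1 / norm (r - s)) *\<^sub>R (X r - (X s + (r - s) *\<^sub>R X'))) ** ?Z s)
        + sgn (r - s) *\<^sub>R ((?Z s - ?Z r) ** X' ** ?Z s)
      = (1 / norm (r - s)) *\<^sub>R (?Z r - (?Z s + (r - s) *\<^sub>R (- (?Z s ** X' ** ?Z s))))"
      unfolding eventually_at_filter by (intro always_eventually allI impI eq)
  qed (simp add: mm.zero_left mm.zero_right)
  then show ?thesis
    unfolding has_vector_derivative_def has_derivative_within
    by (intro conjI bounded_linear_scaleR_left)
qed

text \<open>In reversed time, the blocks acting on terminal data \<open>(a, M a)\<close> form matrices \<open>X\<close> and \<open>Y\<close>
  with \<open>X t = 1\<close> and \<open>Y t = M\<close>. As long as \<open>X\<close> is invertible, \<open>P = Y X\<^sup>-\<^sup>1\<close> maps each state to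
  its costate and solves the Riccati equation; this is where the horizon condition enters.\<close>

lemma riccati_solution:
  fixes A :: "real^'n^'n" and B :: "real^'m^'n" and C :: "real^'n^'p" and M :: "real^'n^'n"
  assumes M_sym: "transpose M = M"
    and inv: "\<And>s. s \<in> {0..t} \<Longrightarrow> invertible (block11 (symplectic_flow A B C s)
                              + block12 (symplectic_flow A B C s) ** M)"
    and t: "0 \<le> t"
  obtains P where "P t = M" "\<And>s. s \<in> {0..t} \<Longrightarrow> transpose (P s) = P s"
    "\<And>s. s \<in> {0..t} \<Longrightarrow> (P has_vector_derivative
       - (transpose C ** C) - transpose A ** P s - P s ** A - P s ** (B ** transpose B) ** P s)
      (at s within {0..t})"
proof -
  interpret mm: bounded_bilinear "(**) :: real^'n^'n \<Rightarrow> real^'n^'n \<Rightarrow> real^'n^'n"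
    by (rule bounded_bilinear_matrix_mult)
  let ?S = "symplectic_flow A B C"
  define X where "X s = block11 (?S (t - s)) + block12 (?S (t - s)) ** M" for s
  define Y where "Y s = block21 (?S (t - s)) + block22 (?S (t - s)) ** M" for s
  define Z where "Z s = matrix_inv (X s)" for s
  define P where "P s = Y s ** Z s" for s
  have D: "((\<lambda>s. f (?S (t - s)) + g (?S (t - s)) ** M) has_vector_derivative - (f' + g' ** M)) (at s)"
    if "((\<lambda>s. f (?S s)) has_vector_derivative f') (at (t - s))"
       "((\<lambda>s. g (?S s)) has_vector_derivative g') (at (t - s))"
    for f g :: "real^('n + 'n)^('n + 'n) \<Rightarrow> real^'n^'n" and f' g' s
  proof -
    have "((\<lambda>s. f (?S s) + g (?S s) ** M) has_vector_derivative (f' + g' ** M)) (at (t - s))"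
      using has_vector_derivative_add[OF that(1) mm.has_vector_derivative[OF that(2) has_vector_derivative_const[of M]]]
      by (simp add: mm.zero_right)
    moreover have "((\<lambda>s. t - s) has_vector_derivative -1) (at s)"
      by (auto intro!: derivative_eq_intros)
    ultimately have "((\<lambda>s. f (?S s) + g (?S s) ** M) \<circ> (\<lambda>s. t - s) has_vector_derivative
        (-1) *\<^sub>R (f' + g' ** M)) (at s)"
      by (intro vector_diff_chain_at)
    then show ?thesis by (simp add: o_def)
  qed
  note mmsimps = mm.diff_left mm.diff_right mm.add_right mm.add_left mm.minus_left mm.minus_right
          matrix_mul_assoc
  have dX: "(X has_vector_derivative A ** X s + (B ** transpose B) ** Y s) (at s)" for s
    unfolding X_def[abs_def]
    by (rule has_vector_derivative_eq_rhs[OF D[OF blocks_flow_has_vector_derivative(1,2)]])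
      (simp add: Y_def mmsimps)
  have dY: "(Y has_vector_derivative - (transpose C ** C) ** X s - transpose A ** Y s) (at s)" for s
    unfolding Y_def[abs_def]
    by (rule has_vector_derivative_eq_rhs[OF D[OF blocks_flow_has_vector_derivative(3,4)]])
      (simp add: X_def mmsimps)
  have Xinv: "invertible (X s)" if "s \<in> {0..t}" for s
    using inv[of "t - s"] that by (simp add: X_def)
  have Xcont: "continuous_on {0..t} X"
    using dX by (meson continuous_at_imp_continuous_on has_vector_derivative_continuous)
  have XZ: "X s ** Z s = mat 1" "Z s ** X s = mat 1" if "s \<in> {0..t}" for s
    using matrix_inv_cancel[OF Xinv[OF that]] by (simp_all add: Z_def)
  have dZ: "(Z has_vector_derivative - (Z s ** (A ** X s + (B ** transpose B) ** Y s) ** Z s)) (at s within {0..t})"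
    if "s \<in> {0..t}" for s
    unfolding Z_def[abs_def]
    by (rule matrix_inv_has_vector_derivative[OF has_vector_derivative_at_within[OF dX] that Xcont Xinv])
  have "X t = mat 1" "Y t = M"
    by (simp_all add: X_def Y_def symplectic_flow_0 blocks_mat_1)
  have "P t = M" using XZ[of t] t by (simp add: P_def \<open>X t = mat 1\<close> \<open>Y t = M\<close>)
  moreover have "transpose (P s) = P s" if s: "s \<in> {0..t}" for s
  proof -
    \<comment> \<open>Both sides come from characteristics with terminal costate \<open>M *v x t\<close>, whose Wronskian vanishes at \<open>t\<close> as \<open>M\<close> is symmetric.\<close>
    have sym: "a \<bullet> (P s *v b) = b \<bullet> (P s *v a)" for a b
    proof -
      have pair: "\<exists>x p. hamiltonian_pair A B C x p \<and> x s = c \<and> p s = P s *v c \<and> p t = M *v x t" for c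
      proof (intro exI conjI)
        note mv = bounded_bilinear.has_vector_derivative[OF bounded_bilinear_matrix_vector_mult
            _ has_vector_derivative_const]
        show "hamiltonian_pair A B C (\<lambda>r. X r *v (Z s *v c)) (\<lambda>r. Y r *v (Z s *v c))"
          unfolding hamiltonian_pair_def
        proof (intro allI conjI)
          fix r
          show "((\<lambda>r. X r *v (Z s *v c)) has_vector_derivative
              A *v (X r *v (Z s *v c)) + B *v (transpose B *v (Y r *v (Z s *v c)))) (at r)"
            by (rule has_vector_derivative_eq_rhs[OF mv[OF dX]])
              (simp add: mm.add_left matrix_vector_mult_add_rdistrib matrix_vector_mul_assoc matrix_mul_assoc)
          show "((\<lambda>r. Y r *v (Z s *v c)) has_vector_derivative
              - (transpose C *v (C *v (X r *v (Z s *v c)))) - transpose A *v (Y r *v (Z s *v c))) (at r)"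
            by (rule has_vector_derivative_eq_rhs[OF mv[OF dY]])
              (simp add: matrix_vector_mult_diff_rdistrib matrix_vector_mult_minus_left
                 matrix_vector_mul_assoc matrix_mul_assoc mm.minus_left mm.diff_left del: transpose_matrix_vector)
        qed
        show "X s *v (Z s *v c) = c"
          by (simp add: matrix_vector_mul_assoc XZ[OF s])
        show "Y s *v (Z s *v c) = P s *v c"
          by (simp add: P_def matrix_vector_mul_assoc)
        show "Y t *v (Z s *v c) = M *v (X t *v (Z s *v c))"
          by (simp add: \<open>X t = mat 1\<close> \<open>Y t = M\<close>)
      qed
      obtain x p where 1: "hamiltonian_pair A B C x p" "x s = a" "p s = P s *v a" "p t = M *v x t"
        using pair by blast
      obtain x' p' where 2: "hamiltonian_pair A B C x' p'" "x' s = b" "p' s = P s *v b" "p' t = M *v x' t"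
        using pair by blast
      have "x t \<bullet> (M *v x' t) = x' t \<bullet> (M *v x t)"
        by (metis M_sym inner_matrix_vector_transpose inner_commute)
      then show ?thesis
        using wronskian_constant[OF 1(1) 2(1), of s t] 1 2 by simp
    qed
    have "transpose (P s) $ i $ j = P s $ i $ j" for i j
      using sym[of "axis j 1" "axis i 1"]
      by (simp add: transpose_def inner_axis' matrix_vector_mul_component inner_axis)
    then show ?thesis by (simp add: vec_eq_iff)
  qed
  moreover have "(P has_vector_derivative
       - (transpose C ** C) - transpose A ** P s - P s ** A - P s ** (B ** transpose B) ** P s)
      (at s within {0..t})" if s: "s \<in> {0..t}" for s
  proof -
    have a: "K ** X s ** Z s = K" for K
      using XZ[OF s] by (simp flip: matrix_mul_assoc)
    show ?thesis
      unfolding P_def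
      by (rule has_vector_derivative_eq_rhs[OF mm.has_vector_derivative[OF has_vector_derivative_at_within[OF dY] dZ[OF s]]])
        (simp add: mmsimps a)
  qed
  ultimately show ?thesis using that by blast
qed

section \<open>Absolutely continuous functions\<close>

lemma sigma_finite_lebesgue: "sigma_finite_measure (lebesgue :: real measure)"
proof
  obtain D :: "real set set" where D: "countable D" "D \<subseteq> sets lborel" "\<Union>D = space lborel"
      "\<forall>a\<in>D. emeasure lborel a \<noteq> \<infinity>"
    using sigma_finite_measure.sigma_finite_countable[OF lborel.sigma_finite_measure_axioms] by blast
  then show "\<exists>D::real set set. countable D \<and> D \<subseteq> sets lebesgue \<and> \<Union>D = space lebesgue \<and>
      (\<forall>a\<in>D. emeasure lebesgue a \<noteq> \<infinity>)"
    by (intro exI[of _ D]) auto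
qed

text \<open>The product of the integrals is the integral of \<open>f r * g s\<close> over the plane. Fubini's theorem on the
  half planes \<open>r \<le> s\<close> and \<open>s < r\<close> turns it into the two terms on the left.\<close>

lemma integration_by_parts_integrable:
  fixes f g :: "real \<Rightarrow> real"
  assumes f: "integrable lebesgue f" and g: "integrable lebesgue g"
  defines "F \<equiv> \<lambda>s. LINT r|lebesgue. indicator {..s} r * f r"
  defines "G \<equiv> \<lambda>s. LINT r|lebesgue. indicator {..s} r * g r"
  shows "integrable lebesgue (\<lambda>s. F s * g s)" "integrable lebesgue (\<lambda>s. f s * G s)"
    "(LINT s|lebesgue. F s * g s) + (LINT s|lebesgue. f s * G s)
       = (LINT s|lebesgue. f s) * (LINT s|lebesgue. g s)"
proof -
  let ?L = "lebesgue :: real measure"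
  interpret L: sigma_finite_measure ?L by (rule sigma_finite_lebesgue)
  interpret P: pair_sigma_finite ?L ?L ..
  have [measurable]: "f \<in> borel_measurable ?L" "g \<in> borel_measurable ?L"
    using f g by auto
  have id[measurable]: "(\<lambda>x. x) \<in> borel_measurable ?L"
    by (rule measurable_completion) simp
  define h where "h = (\<lambda>(r, s). f r * g s)"
  define E where "E = (\<lambda>(r, s). of_bool (r \<le> s) * h (r, s))"
  define E' where "E' = (\<lambda>(r, s). of_bool (s < r) * h (r, s))"
  have hm[measurable]: "h \<in> borel_measurable (?L \<Otimes>\<^sub>M ?L)"
    unfolding h_def by measurable
  have lem: "Measurable.pred (?L \<Otimes>\<^sub>M ?L) (\<lambda>x. fst x \<le> snd x)"
    "Measurable.pred (?L \<Otimes>\<^sub>M ?L) (\<lambda>x. snd x < fst x)"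
    by measurable
  have h: "integrable (?L \<Otimes>\<^sub>M ?L) h"
  proof (rule P.Fubini_integrable[OF hm])
    show "integrable ?L (\<lambda>x. LINT y|?L. norm (h (x, y)))"
      using f g by (simp add: h_def abs_mult)
    show "AE x in ?L. integrable ?L (\<lambda>y. h (x, y))"
      using g by (simp add: h_def)
  qed
  have E: "integrable (?L \<Otimes>\<^sub>M ?L) E"
    using h by (rule Bochner_Integration.integrable_bound)
      (use lem in \<open>auto simp: E_def split_beta intro!: measurable\<close>)
  have E': "integrable (?L \<Otimes>\<^sub>M ?L) E'"
    using h by (rule Bochner_Integration.integrable_bound)
      (use lem in \<open>auto simp: E'_def split_beta intro!: measurable\<close>)
  have "(\<lambda>p. E p + E' p) = h" by (auto simp: E_def E'_def fun_eq_iff)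
  then have sum: "integral\<^sup>L (?L \<Otimes>\<^sub>M ?L) E + integral\<^sup>L (?L \<Otimes>\<^sub>M ?L) E' = integral\<^sup>L (?L \<Otimes>\<^sub>M ?L) h"
    using Bochner_Integration.integral_add[OF E E'] by simp
  have innerE: "(LINT r|?L. E (r, s)) = F s * g s" for s
  proof -
    have "(LINT r|?L. E (r, s)) = (LINT r|?L. (indicator {..s} r * f r) * g s)"
      by (rule Bochner_Integration.integral_cong) (auto simp: E_def h_def indicator_def)
    then show ?thesis by (simp add: F_def)
  qed
  have innerE': "(LINT s|?L. E' (r, s)) = f r * G r" for r
  proof -
    have "(LINT s|?L. E' (r, s)) = (LINT s|?L. f r * (indicator {..r} s * g s))"
    proof (rule integral_cong_AE)
      show "(\<lambda>s. E' (r, s)) \<in> borel_measurable ?L" unfolding E'_def h_def by simp measurable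
      show "(\<lambda>s. f r * (indicator {..r} s * g s)) \<in> borel_measurable ?L" by measurable
      have "AE s in ?L. s \<noteq> r" by (intro AE_completion AE_lborel_singleton)
      then show "AE s in ?L. E' (r, s) = f r * (indicator {..r} s * g s)"
        by eventually_elim (auto simp: E'_def h_def indicator_def)
    qed
    then show ?thesis by (simp add: G_def)
  qed
  have swap: "integrable (?L \<Otimes>\<^sub>M ?L) (\<lambda>(s, r). E (r, s))"
    using E by (rule P.integrable_product_swap)
  show "integrable lebesgue (\<lambda>s. F s * g s)"
    using P.integrable_fst'[OF swap] by (simp add: innerE)
  show "integrable lebesgue (\<lambda>s. f s * G s)"
    using P.integrable_fst'[OF E'] by (simp add: innerE')
  have "(LINT s|lebesgue. F s * g s) = integral\<^sup>L (?L \<Otimes>\<^sub>M ?L) E"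
    using P.integral_snd[of "\<lambda>r s. E (r, s)"] E by (simp add: innerE)
  moreover have "(LINT s|lebesgue. f s * G s) = integral\<^sup>L (?L \<Otimes>\<^sub>M ?L) E'"
    using P.integral_fst'[OF E'] by (simp add: innerE')
  moreover have "integral\<^sup>L (?L \<Otimes>\<^sub>M ?L) h = (LINT s|lebesgue. f s) * (LINT s|lebesgue. g s)"
    using P.integral_fst'[OF h] by (simp add: h_def)
  ultimately show "(LINT s|lebesgue. F s * g s) + (LINT s|lebesgue. f s * G s)
       = (LINT s|lebesgue. f s) * (LINT s|lebesgue. g s)"
    using sum by simp
qed

text \<open>Absolute continuity on \<open>{0..t}\<close>, expressed through a density. States driven by square
  integrable inputs need not be differentiable everywhere, so the calculus of densities replaces
  differentiation along trajectories.\<close>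

definition ac_with_density :: "real \<Rightarrow> (real \<Rightarrow> real) \<Rightarrow> (real \<Rightarrow> real) \<Rightarrow> bool" where
  "ac_with_density t F f \<longleftrightarrow> set_integrable lebesgue {0..t} f \<and>
     (\<forall>s\<in>{0..t}. F s = F 0 + (LINT r:{0..s}|lebesgue. f r))"

lemma ac_with_densityD:
  assumes "ac_with_density t F f" "s \<in> {0..t}"
  shows "set_integrable lebesgue {0..s} f" "F s = F 0 + (LINT r:{0..s}|lebesgue. f r)"
proof -
  have "set_integrable lebesgue {0..t} f"
    using assms(1) unfolding ac_with_density_def by blast
  then show "set_integrable lebesgue {0..s} f"
    by (rule set_integrable_subset) (use assms(2) in auto)
  show "F s = F 0 + (LINT r:{0..s}|lebesgue. f r)"
    using assms unfolding ac_with_density_def by blast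
qed

lemma set_lebesgue_integral_derivative:
  fixes F :: "real \<Rightarrow> 'a::euclidean_space"
  assumes D: "\<And>r. r \<in> {0..t} \<Longrightarrow> (F has_vector_derivative f r) (at r within {0..t})"
    and f: "continuous_on {0..t} f" and s: "s \<in> {0..t}"
  shows "(LINT r:{0..s}|lebesgue. f r) = F s - F 0"
proof -
  have "(f has_integral F s - F 0) {0..s}"
    using s by (intro fundamental_theorem_of_calculus)
      (auto intro: has_vector_derivative_within_subset[OF D])
  moreover have "set_integrable lebesgue {0..s} f"
    using s by (intro absolutely_integrable_continuous_real continuous_on_subset[OF f]) auto
  ultimately show ?thesis
    by (simp add: set_lebesgue_integral_eq_integral integral_unique)
qed

lemma ac_with_density_C1:
  assumes D: "\<And>s. s \<in> {0..t} \<Longrightarrow> (F has_vector_derivative f s) (at s within {0..t})"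
    and f: "continuous_on {0..t} f"
  shows "ac_with_density t F f"
  using set_lebesgue_integral_derivative[OF D f] absolutely_integrable_continuous_real[OF f]
  unfolding ac_with_density_def by simp

lemma ac_with_density_add:
  assumes "ac_with_density t F f" "ac_with_density t G g"
  shows "ac_with_density t (\<lambda>s. F s + G s) (\<lambda>s. f s + g s)"
  unfolding ac_with_density_def
proof (intro conjI ballI)
  show "set_integrable lebesgue {0..t} (\<lambda>s. f s + g s)"
    using assms unfolding ac_with_density_def by (intro set_integral_add(1)) blast+
  fix s assume s: "s \<in> {0..t}"
  show "F s + G s = F 0 + G 0 + (LINT r:{0..s}|lebesgue. f r + g r)"
    using ac_with_densityD(2)[OF assms(1) s] ac_with_densityD(2)[OF assms(2) s]
      set_integral_add(2)[OF ac_with_densityD(1)[OF assms(1) s] ac_with_densityD(1)[OF assms(2) s]]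
    by linarith
qed

lemma ac_with_density_const: "ac_with_density t (\<lambda>s. c) (\<lambda>s. 0)"
  by (simp add: ac_with_density_def set_integrable_def)

lemma ac_with_density_cmult:
  assumes "ac_with_density t F f"
  shows "ac_with_density t (\<lambda>s. c * F s) (\<lambda>s. c * f s)"
  unfolding ac_with_density_def
proof (intro conjI ballI)
  show "set_integrable lebesgue {0..t} (\<lambda>s. c * f s)"
    using assms unfolding ac_with_density_def by (intro set_integrable_mult_right) blast
  fix s assume s: "s \<in> {0..t}"
  show "c * F s = c * F 0 + (LINT r:{0..s}|lebesgue. c * f r)"
    by (subst ac_with_densityD(2)[OF assms s]) (simp add: distrib_left)
qed

lemma ac_with_density_sum:
  assumes "finite I" "\<And>i. i \<in> I \<Longrightarrow> ac_with_density t (F i) (f i)"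
  shows "ac_with_density t (\<lambda>s. \<Sum>i\<in>I. F i s) (\<lambda>s. \<Sum>i\<in>I. f i s)"
  using assms by (induction I) (auto intro: ac_with_density_add ac_with_density_const)

lemma ac_with_density_mult:
  assumes F: "ac_with_density t F f" and G: "ac_with_density t G g"
  shows "ac_with_density t (\<lambda>s. F s * G s) (\<lambda>s. F s * g s + f s * G s)"
proof -
  have main: "set_integrable lebesgue {0..s} (\<lambda>r. F r * g r + f r * G r) \<and>
      F s * G s = F 0 * G 0 + (LINT r:{0..s}|lebesgue. F r * g r + f r * G r)"
    if s: "s \<in> {0..t}" for s
  proof -
    let ?f = "\<lambda>r. indicator {0..s} r * f r" and ?g = "\<lambda>r. indicator {0..s} r * g r"
    define F1 where "F1 r = (LINT q|lebesgue. indicator {..r} q * ?f q)" for r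
    define G1 where "G1 r = (LINT q|lebesgue. indicator {..r} q * ?g q)" for r
    have int: "integrable lebesgue ?f" "integrable lebesgue ?g"
      using ac_with_densityD(1)[OF F s] ac_with_densityD(1)[OF G s]
      by (simp_all add: set_integrable_def)
    note parts = integration_by_parts_integrable[OF int, folded F1_def G1_def]
    have ind: "indicator {..r} q * (indicator {0..s} q * k q) = (indicator {0..r} q * k q :: real)"
      if "r \<in> {0..s}" for r q and k :: "real \<Rightarrow> real"
      using that by (auto simp: indicator_def)
    have F1: "F r = F 0 + F1 r" and G1: "G r = G 0 + G1 r" if r: "r \<in> {0..s}" for r
    proof -
      have "F1 r = (LINT q:{0..r}|lebesgue. f q)" "G1 r = (LINT q:{0..r}|lebesgue. g q)"
        using r by (simp_all add: F1_def G1_def ind set_lebesgue_integral_def)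
      moreover have "r \<in> {0..t}" using r s by auto
      ultimately show "F r = F 0 + F1 r" "G r = G 0 + G1 r"
        using ac_with_densityD(2)[OF F, of r] ac_with_densityD(2)[OF G, of r] by metis+
    qed
    have eq: "indicator {0..s} r * (F r * g r + f r * G r)
        = F 0 * ?g r + F1 r * ?g r + (G 0 * ?f r + ?f r * G1 r)" for r
    proof (cases "r \<in> {0..s}")
      case True
      show ?thesis
        unfolding F1[OF True] G1[OF True] using True by (simp add: algebra_simps)
    qed simp
    have i: "integrable lebesgue (\<lambda>r. F 0 * ?g r + F1 r * ?g r + (G 0 * ?f r + ?f r * G1 r))"
      by (intro Bochner_Integration.integrable_add integrable_mult_right int parts)
    have "(LINT r:{0..s}|lebesgue. F r * g r + f r * G r)
        = F 0 * (LINT r|lebesgue. ?g r) + (LINT r|lebesgue. F1 r * ?g r)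
          + (G 0 * (LINT r|lebesgue. ?f r) + (LINT r|lebesgue. ?f r * G1 r))"
      unfolding set_lebesgue_integral_def real_scaleR_def eq
      by (simp only: Bochner_Integration.integral_add Bochner_Integration.integrable_add
          integrable_mult_right int parts(1,2) integral_mult_right_zero)
    moreover have "(LINT r|lebesgue. ?f r) = F1 s" "(LINT r|lebesgue. ?g r) = G1 s"
      using s by (simp_all add: F1_def G1_def ind)
    ultimately have "F s * G s = F 0 * G 0 + (LINT r:{0..s}|lebesgue. F r * g r + f r * G r)"
      using parts(3) F1[of s] G1[of s] s by (simp add: algebra_simps)
    moreover have "set_integrable lebesgue {0..s} (\<lambda>r. F r * g r + f r * G r)"
      using i unfolding set_integrable_def real_scaleR_def eq .
    ultimately show ?thesis by blast
  qed
  show ?thesis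
  proof (cases "0 \<le> t")
    case True
    then have "set_integrable lebesgue {0..t} (\<lambda>r. F r * g r + f r * G r)"
      using main[of t] by simp
    then show ?thesis unfolding ac_with_density_def using main by blast
  next
    case False
    then show ?thesis by (simp add: ac_with_density_def)
  qed
qed

lemma ac_with_density_inner:
  fixes x y :: "real \<Rightarrow> real^'k"
  assumes "\<And>i. ac_with_density t (\<lambda>s. x s $ i) (\<lambda>s. x' s $ i)"
    "\<And>i. ac_with_density t (\<lambda>s. y s $ i) (\<lambda>s. y' s $ i)"
  shows "ac_with_density t (\<lambda>s. x s \<bullet> y s) (\<lambda>s. x s \<bullet> y' s + x' s \<bullet> y s)"
  unfolding inner_vec_def inner_real_def sum.distrib[symmetric]
  by (intro ac_with_density_sum ac_with_density_mult assms) auto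

lemma ac_with_density_component:
  fixes x :: "real \<Rightarrow> real^'k"
  assumes D: "\<And>s. s \<in> {0..t} \<Longrightarrow> (x has_vector_derivative x' s) (at s within {0..t})"
    and x': "continuous_on {0..t} x'"
  shows "ac_with_density t (\<lambda>s. x s $ i) (\<lambda>s. x' s $ i)"
  by (rule ac_with_density_C1)
    (auto intro: bounded_linear.has_vector_derivative[OF bounded_linear_vec_nth D]
      continuous_on_component x')


section \<open>Optimality of characteristics\<close>

text \<open>Let \<open>(x, p)\<close> be a point of a characteristic, with input \<open>w\<close>, and let \<open>h\<close> and \<open>v\<close> perturb its
  state and input. The running payoff gained by the perturbation, plus the derivative of
  \<open>(1/2 * P h + p) \<bullet> h\<close> along it, is a negative square: the costate equation cancels the terms
  linear in the perturbation, and the Riccati equation leaves the square among the quadratic ones.\<close>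

lemma completion_of_squares:
  fixes A :: "real^'n^'n" and B :: "real^'m^'n" and C :: "real^'n^'p" and P :: "real^'n^'n"
    and x p h :: "real^'n" and v :: "real^'m"
  defines "w \<equiv> transpose B *v p"
    and "h' \<equiv> A *v h + B *v v"
    and "P' \<equiv> - (transpose C ** C) - transpose A ** P - P ** A - P ** (B ** transpose B) ** P"
    and "p' \<equiv> - (transpose C *v (C *v x)) - transpose A *v p"
  assumes P_sym: "transpose P = P"
  shows "(1/2 * (norm (C *v (x + h)))\<^sup>2 - 1/2 * (norm (w + v))\<^sup>2)
      - (1/2 * (norm (C *v x))\<^sup>2 - 1/2 * (norm w)\<^sup>2)
      + (((1/2) *\<^sub>R (P *v h) + p) \<bullet> h' + ((1/2) *\<^sub>R (P *v h' + P' *v h) + p') \<bullet> h)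
    = - (1/2 * (norm (v - transpose B *v (P *v h)))\<^sup>2)"
proof -
  define k where "k = P *v h"
  have adjC: "(transpose C *v b) \<bullet> a = (C *v a) \<bullet> b" for a b
    by (metis inner_matrix_vector_transpose inner_commute transpose_transpose)
  have adjA: "(transpose A *v b) \<bullet> a = (A *v a) \<bullet> b" for a b
    by (metis inner_matrix_vector_transpose inner_commute transpose_transpose)
  have adjB: "b \<bullet> (B *v a) = a \<bullet> (transpose B *v b)" for a b
    by (metis inner_matrix_vector_transpose inner_commute)
  have adjP: "(P *v a) \<bullet> h = a \<bullet> k" for a
    by (metis inner_matrix_vector_transpose inner_commute P_sym k_def)
  have "P' *v h = - (transpose C *v (C *v h)) - transpose A *v k - P *v (A *v h)
      - P *v (B *v (transpose B *v k))"
    by (simp add: P'_def k_def matrix_vector_mult_diff_rdistrib matrix_vector_mult_minus_left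
        matrix_vector_mul_assoc matrix_mul_assoc del: transpose_matrix_vector)
  then have Q: "(P' *v h) \<bullet> h = - ((C *v h) \<bullet> (C *v h)) - 2 * ((A *v h) \<bullet> k)
      - (transpose B *v k) \<bullet> (transpose B *v k)"
    by (simp add: inner_diff_left inner_add_left adjC adjA adjP inner_commute[of "B *v _" k] adjB
        del: transpose_matrix_vector)
  have k': "k \<bullet> h' = (A *v h) \<bullet> k + v \<bullet> (transpose B *v k)"
    by (simp add: h'_def inner_add_right adjB inner_commute del: transpose_matrix_vector)
  have p': "p' \<bullet> h = - ((C *v h) \<bullet> (C *v x)) - (A *v h) \<bullet> p"
    by (simp add: p'_def inner_diff_left adjC adjA del: transpose_matrix_vector)
  have ph: "p \<bullet> h' = (A *v h) \<bullet> p + v \<bullet> w"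
    by (simp add: h'_def w_def inner_add_right adjB inner_commute del: transpose_matrix_vector)
  have Ph': "(P *v h') \<bullet> h = k \<bullet> h'"
    by (simp add: adjP inner_commute[of h'])
  have F: "((1/2) *\<^sub>R k + p) \<bullet> h' + ((1/2) *\<^sub>R (P *v h' + P' *v h) + p') \<bullet> h
      = k \<bullet> h' + p \<bullet> h' + 1/2 * ((P' *v h) \<bullet> h) + p' \<bullet> h"
    by (simp add: inner_add_left Ph' algebra_simps)
  show ?thesis
    unfolding k_def[symmetric] F unfolding Q k' p' ph
    by (simp add: power2_norm_eq_inner matrix_vector_right_distrib inner_add_left inner_add_right
        inner_diff_left inner_diff_right inner_commute algebra_simps del: transpose_matrix_vector)
qed

text \<open>On a bounded interval this follows from \<open>norm w \<le> 1 + (norm w)\<^sup>2\<close>.\<close>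

lemma set_integrable_L2:
  assumes "w \<in> L2_on t"
  shows "set_integrable lebesgue {0..t} w"
proof (rule set_integrable_bound)
  have "set_integrable lebesgue {0..t} (\<lambda>s. 1 :: real)"
    by (rule absolutely_integrable_continuous_real) simp
  then show "set_integrable lebesgue {0..t} (\<lambda>s. 1 + (norm (w s))\<^sup>2)"
    using assms by (intro set_integral_add(1)) (auto simp: L2_on_def)
  show "set_borel_measurable lebesgue {0..t} w"
    using assms by (simp add: L2_on_def)
  have "norm (w s) \<le> 1 + (norm (w s))\<^sup>2" for s
  proof (cases "norm (w s) \<le> 1")
    case False
    then show ?thesis by (smt (verit) power2_eq_square mult_le_cancel_right1)
  qed (simp add: add_increasing2)
  then show "AE s in lebesgue. s \<in> {0..t} \<longrightarrow> norm (w s) \<le> norm (1 + (norm (w s))\<^sup>2)"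
    by (intro always_eventually allI impI) (metis abs_of_nonneg norm_ge_zero order_trans real_norm_def)
qed

lemma set_integrable_linear_image:
  fixes w :: "real \<Rightarrow> real^'m" and B :: "real^'m^'n"
  assumes "set_integrable lebesgue S w"
  shows "set_integrable lebesgue S (\<lambda>s. B *v w s)"
proof -
  have "integrable lebesgue (\<lambda>s. B *v (indicator S s *\<^sub>R w s))"
    using assms unfolding set_integrable_def
    by (intro integrable_bounded_linear[OF matrix_vector_mul_bounded_linear])
  then show ?thesis
    by (simp add: set_integrable_def matrix_vector_mult_scaleR)
qed

lemma set_integral_vec_nth:
  fixes f :: "real \<Rightarrow> real^'n"
  assumes "set_integrable lebesgue S f"
  shows "set_integrable lebesgue S (\<lambda>s. f s $ i)"
    "(LINT s:S|lebesgue. f s) $ i = (LINT s:S|lebesgue. f s $ i)"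
proof -
  have f: "integrable lebesgue (\<lambda>s. indicator S s *\<^sub>R f s)"
    using assms by (simp add: set_integrable_def)
  show "set_integrable lebesgue S (\<lambda>s. f s $ i)"
    using integrable_bounded_linear[OF bounded_linear_vec_nth f, of i]
    by (simp add: set_integrable_def)
  show "(LINT s:S|lebesgue. f s) $ i = (LINT s:S|lebesgue. f s $ i)"
    using integral_bounded_linear[OF bounded_linear_vec_nth f, of i]
    by (simp add: set_lebesgue_integral_def)
qed

lemma state_trajectory_ac:
  fixes A :: "real^'n^'n" and B :: "real^'m^'n"
  assumes x: "state_trajectory A B t x0 w x" and w: "w \<in> L2_on t" and t: "0 \<le> t"
  shows "x 0 = x0" "ac_with_density t (\<lambda>s. x s $ i) (\<lambda>s. (A *v x s + B *v w s) $ i)"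
proof -
  have cont: "continuous_on {0..t} x" using x by (simp add: state_trajectory_def)
  have eq: "x s = x0 + (LINT r:{0..s}|lebesgue. A *v x r + B *v w r)" if "s \<in> {0..t}" for s
    using x that unfolding state_trajectory_def by blast
  have "set_integrable lebesgue {0..t} (\<lambda>s. A *v x s)"
    by (intro set_integrable_linear_image absolutely_integrable_continuous_real cont)
  then have int: "set_integrable lebesgue {0..t} (\<lambda>s. A *v x s + B *v w s)"
    by (rule set_integral_add(1)) (rule set_integrable_linear_image[OF set_integrable_L2[OF w]])
  have int_s: "set_integrable lebesgue {0..s} (\<lambda>s. A *v x s + B *v w s)" if "s \<in> {0..t}" for s
    by (rule set_integrable_subset[OF int]) (use that in auto)
  have "(LINT r:{0..0}|lebesgue. A *v x r + B *v w r) = 0"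
    using int_s[of 0] t by (simp add: set_lebesgue_integral_eq_integral)
  then show x0: "x 0 = x0" using eq[of 0] t by simp
  show "ac_with_density t (\<lambda>s. x s $ i) (\<lambda>s. (A *v x s + B *v w s) $ i)"
    unfolding ac_with_density_def
  proof (intro conjI ballI)
    show "set_integrable lebesgue {0..t} (\<lambda>s. (A *v x s + B *v w s) $ i)"
      by (rule set_integral_vec_nth(1)[OF int])
    fix s assume s: "s \<in> {0..t}"
    show "x s $ i = x 0 $ i + (LINT r:{0..s}|lebesgue. (A *v x r + B *v w r) $ i)"
      using eq[OF s] x0 set_integral_vec_nth(2)[OF int_s[OF s], of i] by (metis vector_add_component)
  qed
qed

lemma hamiltonian_pair_continuous:
  assumes "hamiltonian_pair A B C x p"
  shows "continuous_on T x" "continuous_on T p"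
  using assms unfolding hamiltonian_pair_def
  by (meson continuous_at_imp_continuous_on has_vector_derivative_continuous)+

text \<open>The payoff has a closed form because the running payoff is the derivative of
  \<open>- (1/2) * (x s \<bullet> p s)\<close> along a characteristic.\<close>

lemma hamiltonian_pair_admissible:
  assumes hp: "hamiltonian_pair A B C x p" and t: "0 \<le> t"
  defines "w \<equiv> \<lambda>s. transpose B *v p s"
  shows "w \<in> L2_on t" "state_trajectory A B t (x 0) w x"
    "running_payoff C t w x = 1/2 * (x 0 \<bullet> p 0 - x t \<bullet> p t)"
proof -
  note cont = hamiltonian_pair_continuous[OF hp] continuous_on_matrix_vector_mult continuous_on_const
  have w: "continuous_on {0..t} w"
    unfolding w_def by (intro cont)
  show "w \<in> L2_on t"
    using absolutely_integrable_continuous_real[OF w]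
      absolutely_integrable_continuous_real[OF continuous_on_power[OF continuous_on_norm[OF w], of 2]]
    by (auto simp: L2_on_def set_integrable_def set_borel_measurable_def)
  have dx: "(x has_vector_derivative A *v x s + B *v w s) (at s)"
    and dp: "(p has_vector_derivative - (transpose C *v (C *v x s)) - transpose A *v p s) (at s)" for s
    using hp unfolding hamiltonian_pair_def w_def by blast+
  have "(LINT r:{0..s}|lebesgue. A *v x r + B *v w r) = x s - x 0" if "s \<in> {0..t}" for s
    by (rule set_lebesgue_integral_derivative[where t = t])
      (use that in \<open>auto intro!: has_vector_derivative_at_within dx continuous_on_add cont w\<close>)
  then show "state_trajectory A B t (x 0) w x"
    using cont(1)[of "{0..t}"] by (simp add: state_trajectory_def)
  have adjC: "a \<bullet> (transpose C *v b) = (C *v a) \<bullet> b" for a b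
    by (metis inner_matrix_vector_transpose transpose_transpose)
  have adjA: "a \<bullet> (transpose A *v b) = (A *v a) \<bullet> b" for a b
    by (metis inner_matrix_vector_transpose transpose_transpose)
  have adjB: "(B *v a) \<bullet> b = a \<bullet> (transpose B *v b)" for a b
    by (metis inner_matrix_vector_transpose inner_commute)
  have "((\<lambda>s. - (1/2) * (x s \<bullet> p s)) has_vector_derivative
      1/2 * (norm (C *v x s))\<^sup>2 - 1/2 * (norm (w s))\<^sup>2) (at s within {0..t})" for s
    by (rule has_vector_derivative_at_within,
        rule has_vector_derivative_eq_rhs[OF has_vector_derivative_mult_right[OF
          bounded_bilinear.has_vector_derivative[OF bounded_bilinear_inner dx dp]]])
      (simp add: power2_norm_eq_inner inner_add_left inner_diff_right adjA adjB adjC w_def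
        algebra_simps del: transpose_matrix_vector)
  moreover have "continuous_on {0..t} (\<lambda>s. 1/2 * (norm (C *v x s))\<^sup>2 - 1/2 * (norm (w s))\<^sup>2)"
    by (intro continuous_intros cont w)
  ultimately show "running_payoff C t w x = 1/2 * (x 0 \<bullet> p 0 - x t \<bullet> p t)"
    unfolding running_payoff_def
    by (subst set_lebesgue_integral_derivative[where t = t]) (use t in \<open>auto simp: algebra_simps\<close>)
qed

lemma payoff_integrable:
  fixes C :: "real^'n^'p" and w :: "real \<Rightarrow> real^'m"
  assumes w: "w \<in> L2_on t" and x: "continuous_on {0..t} x"
  shows "set_integrable lebesgue {0..t} (\<lambda>s. 1/2 * (norm (C *v x s))\<^sup>2 - 1/2 * (norm (w s))\<^sup>2)"
proof (intro set_integral_diff(1) set_integrable_mult_right)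
  show "set_integrable lebesgue {0..t} (\<lambda>s. (norm (C *v x s))\<^sup>2)"
    by (intro absolutely_integrable_continuous_real continuous_on_power continuous_on_norm
        continuous_on_matrix_vector_mult[OF continuous_on_const x])
  show "set_integrable lebesgue {0..t} (\<lambda>s. (norm (w s))\<^sup>2)"
    using w by (simp add: L2_on_def)
qed

text \<open>Sufficiency of the transversality condition. With \<open>h\<close> the deviation from the characteristic,
  the function \<open>(1/2 * P h + p) \<bullet> h\<close> vanishes at time \<open>0\<close> and equals at time \<open>t\<close> the difference of the
  two terminal payoffs. Its increment is the integral of its density, and by completion of
  squares that density plus the difference of the running payoffs is never positive.\<close>

lemma hamiltonian_pair_optimal:
  fixes A :: "real^'n^'n" and B :: "real^'m^'n" and C :: "real^'n^'p" and M :: "real^'n^'n"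
  assumes M_sym: "transpose M = M"
    and inv: "\<And>s. s \<in> {0..t} \<Longrightarrow> invertible (block11 (symplectic_flow A B C s)
                              + block12 (symplectic_flow A B C s) ** M)"
    and t: "0 \<le> t"
    and hp: "hamiltonian_pair A B C xs ps" and pt: "ps t = M *v (xs t - z)"
    and w: "w \<in> L2_on t" and x: "state_trajectory A B t (xs 0) w x"
  shows "running_payoff C t w x + basis_fun M (x t) z
    \<le> running_payoff C t (\<lambda>s. transpose B *v ps s) xs + basis_fun M (xs t) z"
proof -
  interpret mm: bounded_bilinear "(**) :: real^'n^'n \<Rightarrow> real^'n^'n \<Rightarrow> real^'n^'n"
    by (rule bounded_bilinear_matrix_mult)
  obtain P where PT: "P t = M" and P_sym: "\<And>s. s \<in> {0..t} \<Longrightarrow> transpose (P s) = P s"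
    and dP: "\<And>s. s \<in> {0..t} \<Longrightarrow> (P has_vector_derivative
       - (transpose C ** C) - transpose A ** P s - P s ** A - P s ** (B ** transpose B) ** P s)
      (at s within {0..t})"
    using riccati_solution[OF M_sym inv t] by blast
  define ws where "ws s = transpose B *v ps s" for s
  define h where "h s = x s - xs s" for s
  define v where "v s = w s - ws s" for s
  define h' where "h' s = A *v h s + B *v v s" for s
  define P' where "P' s = - (transpose C ** C) - transpose A ** P s - P s ** A
     - P s ** (B ** transpose B) ** P s" for s
  define p' where "p' s = - (transpose C *v (C *v xs s)) - transpose A *v ps s" for s
  define F where "F s = (1/2) *\<^sub>R (P s *v h s) + ps s" for s
  define F' where "F' s = (1/2) *\<^sub>R (P s *v h' s + P' s *v h s) + p' s" for s
  note xs = hamiltonian_pair_admissible[OF hp t, folded ws_def]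
  note contp = hamiltonian_pair_continuous[OF hp]
  have contP: "continuous_on {0..t} P"
    using dP by (meson continuous_on_eq_continuous_within has_vector_derivative_continuous)
  have ac_h: "ac_with_density t (\<lambda>s. h s $ i) (\<lambda>s. h' s $ i)" for i
  proof -
    have "ac_with_density t (\<lambda>s. x s $ i + (-1) * xs s $ i)
        (\<lambda>s. (A *v x s + B *v w s) $ i + (-1) * (A *v xs s + B *v ws s) $ i)"
      by (intro ac_with_density_add ac_with_density_cmult state_trajectory_ac(2)[OF x w t]
          state_trajectory_ac(2)[OF xs(2) xs(1) t, folded ws_def])
    then show ?thesis
      by (simp add: h_def h'_def v_def matrix_vector_mult_diff_distrib algebra_simps)
  qed
  have ac_P: "ac_with_density t (\<lambda>s. P s $ i $ j) (\<lambda>s. P' s $ i $ j)" for i j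
  proof (rule ac_with_density_C1)
    show "((\<lambda>s. P s $ i $ j) has_vector_derivative P' s $ i $ j) (at s within {0..t})"
      if "s \<in> {0..t}" for s
      using dP[OF that] unfolding P'_def
      by (intro bounded_linear.has_vector_derivative[OF bounded_linear_vec_nth])
    show "continuous_on {0..t} (\<lambda>s. P' s $ i $ j)"
      unfolding P'_def by (intro continuous_on_component continuous_on_diff continuous_on_minus
          continuous_on_const mm.continuous_on contP)
  qed
  have ac_p: "ac_with_density t (\<lambda>s. ps s $ i) (\<lambda>s. p' s $ i)" for i
  proof (rule ac_with_density_component)
    show "(ps has_vector_derivative p' s) (at s within {0..t})" for s
      using hp unfolding hamiltonian_pair_def p'_def by (blast intro: has_vector_derivative_at_within)
    show "continuous_on {0..t} p'"
      unfolding p'_def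
      by (intro continuous_on_diff continuous_on_minus continuous_on_matrix_vector_mult
          continuous_on_const contp)
  qed
  have ac_F: "ac_with_density t (\<lambda>s. F s $ i) (\<lambda>s. F' s $ i)" for i
  proof -
    have row: "(P s *v a) $ i = P s $ i \<bullet> a" "(P' s *v a) $ i = P' s $ i \<bullet> a" for s a
      by (simp_all add: matrix_vector_mul_component)
    have "ac_with_density t (\<lambda>s. (1/2) * (P s $ i \<bullet> h s) + ps s $ i)
       (\<lambda>s. (1/2) * (P s $ i \<bullet> h' s + P' s $ i \<bullet> h s) + p' s $ i)"
      by (intro ac_with_density_add ac_with_density_cmult ac_with_density_inner ac_P ac_h ac_p)
    then show ?thesis
      by (simp add: F_def F'_def row)
  qed
  have ac_U: "ac_with_density t (\<lambda>s. F s \<bullet> h s) (\<lambda>s. F s \<bullet> h' s + F' s \<bullet> h s)"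
    by (rule ac_with_density_inner[OF ac_F ac_h])
  have h0: "h 0 = 0"
    using state_trajectory_ac(1)[OF x w t] by (simp add: h_def)
  let ?l = "\<lambda>s. 1/2 * (norm (C *v x s))\<^sup>2 - 1/2 * (norm (w s))\<^sup>2"
  let ?ls = "\<lambda>s. 1/2 * (norm (C *v xs s))\<^sup>2 - 1/2 * (norm (ws s))\<^sup>2"
  let ?u = "\<lambda>s. F s \<bullet> h' s + F' s \<bullet> h s"
  have t0: "t \<in> {0..t}" using t by simp
  have x_cont: "continuous_on {0..t} x" using x by (simp add: state_trajectory_def)
  have int: "set_integrable lebesgue {0..t} ?l" "set_integrable lebesgue {0..t} ?ls"
    "set_integrable lebesgue {0..t} ?u"
    using payoff_integrable[OF w x_cont] payoff_integrable[OF xs(1) contp(1), folded ws_def]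
      ac_with_densityD(1)[OF ac_U t0] by simp_all
  have int_d: "set_integrable lebesgue {0..t} (\<lambda>s. ?l s - ?ls s)"
    by (rule set_integral_diff(1)[OF int(1,2)])
  have nonpos: "?l s - ?ls s + ?u s \<le> 0" if s: "s \<in> {0..t}" for s
  proof -
    have "?l s - ?ls s + ?u s = - (1/2 * (norm (v s - transpose B *v (P s *v h s)))\<^sup>2)"
      using completion_of_squares[OF P_sym[OF s], of C "xs s" "h s" B "ps s" "v s" A]
      unfolding F_def F'_def h'_def P'_def p'_def ws_def[symmetric]
      by (simp add: h_def v_def)
    then show ?thesis by simp
  qed
  have "(LINT s:{0..t}|lebesgue. (?l s - ?ls s) + ?u s) \<le> (LINT s:{0..t}|lebesgue. 0)"
    by (rule set_integral_mono) (use nonpos set_integral_add(1)[OF int_d int(3)] in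
        \<open>auto simp: set_integrable_def\<close>)
  then have "running_payoff C t w x - running_payoff C t ws xs + (LINT s:{0..t}|lebesgue. ?u s) \<le> 0"
    unfolding running_payoff_def
    using set_integral_add(2)[OF int_d int(3)] set_integral_diff(2)[OF int(1,2)] by simp
  moreover have "F t \<bullet> h t = (LINT s:{0..t}|lebesgue. ?u s)"
    using ac_with_densityD(2)[OF ac_U t0] h0 by simp
  moreover have "basis_fun M (x t) z - basis_fun M (xs t) z = F t \<bullet> h t"
  proof -
    have xt: "x t - z = (xs t - z) + h t" by (simp add: h_def)
    have "(xs t - z) \<bullet> (M *v h t) = h t \<bullet> (M *v (xs t - z))"
      by (metis inner_matrix_vector_transpose inner_commute M_sym)
    then show ?thesis
      unfolding basis_fun_def xt F_def PT pt
      by (simp add: matrix_vector_right_distrib inner_add_left inner_add_right inner_commute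
          algebra_simps)
  qed
  ultimately show ?thesis by (simp add: ws_def[abs_def])
qed

section \<open>Max-plus kernel and duality\<close>

lemma max_horizon_infinite_invertible:
  assumes "max_horizon A B C M = \<infinity>" and s: "0 \<le> s"
  shows "invertible (block11 (symplectic_flow A B C s) + block12 (symplectic_flow A B C s) ** M)"
proof (cases "s = 0")
  case True
  then show ?thesis by (simp add: symplectic_flow_0 blocks_mat_1 invertible_def exI[of _ "mat 1"])
next
  case False
  have "ereal s < max_horizon A B C M" using assms(1) by simp
  then obtain r where "s < r" and r: "\<forall>q\<in>{0<..r}. invertible (block11 (symplectic_flow A B C q)
      + block12 (symplectic_flow A B C q) ** M)"
    unfolding max_horizon_def less_Sup_iff by auto
  with False s show ?thesis by auto
qed

text \<open>A characteristic can be prescribed by its initial state \<open>x\<close> and by the defect \<open>r\<close> in the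
  terminal condition \<open>p t = M x t\<close>. Its endpoint is then affine in \<open>r\<close>; with
  \<open>X = \<Sigma>\<^sup>1\<^sup>1 + \<Sigma>\<^sup>1\<^sup>2 M\<close> the matrices are \<open>E = X\<^sup>-\<^sup>1\<close> and \<open>W = X\<^sup>-\<^sup>1 \<Sigma>\<^sup>1\<^sup>2\<close>.\<close>

lemma hamiltonian_pair_with_initial_state:
  fixes A :: "real^'n^'n" and B :: "real^'m^'n" and C :: "real^'n^'p" and M :: "real^'n^'n"
  assumes inv: "invertible (block11 (symplectic_flow A B C t) + block12 (symplectic_flow A B C t) ** M)"
  obtains W E :: "real^'n^'n" where
    "\<And>q. W *v q = 0 \<Longrightarrow> block12 (symplectic_flow A B C t) *v q = 0"
    "\<And>x r. \<exists>xs ps. hamiltonian_pair A B C xs ps \<and> xs 0 = x \<and>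
       xs t = E *v x - W *v r \<and> ps t = M *v xs t + r"
proof -
  let ?S = "symplectic_flow A B C t"
  let ?X = "block11 ?S + block12 ?S ** M"
  let ?Z = "matrix_inv ?X"
  have XZ: "?X *v (?Z *v a) = a" for a
    by (simp add: matrix_vector_mul_assoc matrix_inv_cancel[OF inv])
  show ?thesis
  proof (rule that[of "?Z ** block12 ?S" ?Z])
    fix q assume "(?Z ** block12 ?S) *v q = 0"
    then show "block12 ?S *v q = 0"
      using XZ[of "block12 ?S *v q"] by (simp add: matrix_vector_mul_assoc)
  next
    fix x r
    define y where "y = ?Z *v (x - block12 ?S *v r)"
    obtain xs ps where hp: "hamiltonian_pair A B C xs ps" "xs t = y" "ps t = M *v y + r"
      "xs 0 = block11 ?S *v y + block12 ?S *v (M *v y + r)"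
      using hamiltonian_pair_with_terminal by blast
    have "xs 0 = ?X *v y + block12 ?S *v r"
      by (simp add: hp(4) matrix_vector_right_distrib matrix_vector_mult_add_rdistrib
          matrix_vector_mul_assoc)
    also have "\<dots> = x" unfolding y_def XZ by simp
    finally have "xs 0 = x" .
    moreover have "y = ?Z *v x - (?Z ** block12 ?S) *v r"
      by (simp add: y_def matrix_vector_mult_diff_distrib matrix_vector_mul_assoc)
    ultimately show "\<exists>xs ps. hamiltonian_pair A B C xs ps \<and> xs 0 = x \<and>
       xs t = ?Z *v x - (?Z ** block12 ?S) *v r \<and> ps t = M *v xs t + r"
      using hp by metis
  qed
qed

lemma aux_value_ge:
  assumes "w \<in> L2_on t" "state_trajectory A B t x0 w x"
  shows "ereal (running_payoff C t w x + basis_fun M (x t) z) \<le> aux_value A B C M t x0 z"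
  unfolding aux_value_def dp_evolution_def
  by (rule SUP_upper2[of "(w, x)"]) (use assms in auto)

lemma hamiltonian_pair_value:
  assumes hp: "hamiltonian_pair A B C x p" and t: "0 \<le> t" and pt: "p t = M *v (x t - z)"
  shows "running_payoff C t (\<lambda>s. transpose B *v p s) x + basis_fun M (x t) z
      = 1/2 * (x 0 \<bullet> p 0 - z \<bullet> p t)"
  unfolding hamiltonian_pair_admissible(3)[OF hp t] basis_fun_def pt[symmetric]
  by (simp add: inner_diff_left field_simps)

lemma aux_value_eq:
  fixes A :: "real^'n^'n" and B :: "real^'m^'n" and C :: "real^'n^'p" and M :: "real^'n^'n"
  assumes M_sym: "transpose M = M" and horizon: "max_horizon A B C M = \<infinity>" and t: "0 \<le> t"
    and hp: "hamiltonian_pair A B C x p" and pt: "p t = M *v (x t - z)"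
  shows "aux_value A B C M t (x 0) z = ereal (1/2 * (x 0 \<bullet> p 0 - z \<bullet> p t))"
proof -
  note adm = hamiltonian_pair_admissible[OF hp t]
  note val = hamiltonian_pair_value[OF hp t pt]
  show ?thesis
  proof (rule antisym)
    show "aux_value A B C M t (x 0) z \<le> ereal (1/2 * (x 0 \<bullet> p 0 - z \<bullet> p t))"
      unfolding aux_value_def dp_evolution_def
    proof (rule SUP_least, clarify)
      fix w y assume "w \<in> L2_on t" "state_trajectory A B t (x 0) w y"
      from hamiltonian_pair_optimal[OF M_sym max_horizon_infinite_invertible[OF horizon] t hp pt this]
      show "ereal (running_payoff C t w y) + ereal (basis_fun M (y t) z)
          \<le> ereal (1/2 * (x 0 \<bullet> p 0 - z \<bullet> p t))"
        unfolding val by simp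
    qed
    show "ereal (1/2 * (x 0 \<bullet> p 0 - z \<bullet> p t)) \<le> aux_value A B C M t (x 0) z"
      using aux_value_ge[OF adm(1,2), of C M z] by (simp only: val)
  qed
qed

lemma dp_evolution_delta_le_iff:
  "dp_evolution A B C t (\<lambda>\<xi>. maxplus_delta \<xi> y) x0 \<le> c \<longleftrightarrow>
    (\<forall>w x. w \<in> L2_on t \<longrightarrow> state_trajectory A B t x0 w x \<longrightarrow> x t = y \<longrightarrow> ereal (running_payoff C t w x) \<le> c)"
  unfolding dp_evolution_def maxplus_delta_def SUP_le_iff by auto

text \<open>Admissible trajectories are grouped by their endpoint. Finiteness of the kernel from above is
  essential, because \<open>\<infinity> + - \<infinity> = \<infinity>\<close> in \<^typ>\<open>ereal\<close>.\<close>

lemma dp_evolution_eq_maxplus_integral: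
  assumes fin: "\<And>x y. dp_evolution A B C t (\<lambda>\<xi>. maxplus_delta \<xi> y) x \<noteq> \<infinity>"
    and \<psi>: "Rminus_valued \<psi>"
  shows "dp_evolution A B C t \<psi>
    = maxplus_integral_op (\<lambda>x y. dp_evolution A B C t (\<lambda>\<xi>. maxplus_delta \<xi> y) x) \<psi>"
proof (rule ext, rule antisym)
  fix x0
  let ?G = "\<lambda>y. dp_evolution A B C t (\<lambda>\<xi>. maxplus_delta \<xi> y) x0"
  show "dp_evolution A B C t \<psi> x0 \<le> maxplus_integral_op (\<lambda>x y. dp_evolution A B C t (\<lambda>\<xi>. maxplus_delta \<xi> y) x) \<psi> x0"
    unfolding dp_evolution_def[of A B C t \<psi>] maxplus_integral_op_def
  proof (rule SUP_least, clarify)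
    fix w x assume "w \<in> L2_on t" "state_trajectory A B t x0 w x"
    then have "ereal (running_payoff C t w x) \<le> ?G (x t)"
      using dp_evolution_delta_le_iff[of A B C t "x t" x0 "?G (x t)"] by blast
    then have "ereal (running_payoff C t w x) + \<psi> (x t) \<le> ?G (x t) + \<psi> (x t)"
      by (rule add_right_mono)
    also have "\<dots> \<le> (SUP y. ?G y + \<psi> y)" by (rule SUP_upper) simp
    finally show "ereal (running_payoff C t w x) + \<psi> (x t) \<le> (SUP y. ?G y + \<psi> y)" .
  qed
  show "maxplus_integral_op (\<lambda>x y. dp_evolution A B C t (\<lambda>\<xi>. maxplus_delta \<xi> y) x) \<psi> x0 \<le> dp_evolution A B C t \<psi> x0"
    unfolding maxplus_integral_op_def
  proof (rule SUP_least)
    fix y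
    show "?G y + \<psi> y \<le> dp_evolution A B C t \<psi> x0"
    proof (cases "\<psi> y")
      case (real r)
      have "?G y \<le> dp_evolution A B C t \<psi> x0 - ereal r"
        unfolding dp_evolution_delta_le_iff
      proof (intro allI impI)
        fix w x assume "w \<in> L2_on t" "state_trajectory A B t x0 w x" "x t = y"
        then have "ereal (running_payoff C t w x) + ereal r \<le> dp_evolution A B C t \<psi> x0"
          unfolding dp_evolution_def by (intro SUP_upper2[of "(w, x)"]) (auto simp: real)
        then show "ereal (running_payoff C t w x) \<le> dp_evolution A B C t \<psi> x0 - ereal r"
          by (simp add: ereal_le_minus)
      qed
      then show ?thesis by (simp add: real ereal_le_minus)
    next
      case PInf
      then show ?thesis using \<psi> by (simp add: Rminus_valued_def)
    next
      case MInf
      then show ?thesis using fin[of y x0] by (cases "?G y") auto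
    qed
  qed
qed

text \<open>The Fredholm alternative: the range of a symmetric matrix is the orthogonal complement of its
  kernel.\<close>

lemma symmetric_matrix_solvable:
  fixes W :: "real^'k^'k"
  assumes sym: "\<And>a b. (W *v a) \<bullet> b = (W *v b) \<bullet> a"
    and ortho: "\<And>u. W *v u = 0 \<Longrightarrow> u \<bullet> d = 0"
  obtains r where "W *v r = d"
proof -
  obtain a b where ab: "a \<in> span (range ((*v) W))" "\<And>c. c \<in> span (range ((*v) W)) \<Longrightarrow> orthogonal b c"
    and d: "d = a + b"
    using orthogonal_subspace_decomp_exists[of "range ((*v) W)" d] by metis
  have "(W *v b) \<bullet> c = 0" for c
    using ab(2)[of "W *v c"] sym[of b c] by (simp add: span_base orthogonal_def inner_commute)
  then have "W *v b = 0" by (metis inner_eq_zero_iff)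
  then have "b \<bullet> (a + b) = 0" using ortho d by blast
  moreover have "b \<bullet> a = 0" using ab by (simp add: orthogonal_def)
  ultimately have "b = 0" by (simp add: inner_add_right)
  moreover have "subspace (range ((*v) W))"
    by (intro linear_subspace_image subspace_UNIV) simp
  ultimately show ?thesis using ab(1) d that by (auto simp: span_eq_iff[THEN iffD2])
qed

text \<open>For a fixed trajectory, subtracting \<open>1/2 * (z \<bullet> (M *v z))\<close> from the payoff leaves an affine function
  of \<open>z\<close>, so the difference is a supremum of affine functions. As the supremum at an intermediate
  point is attained by a characteristic, comparing with that trajectory at the two ends suffices.\<close>

lemma aux_value_semiconvex:
  fixes A :: "real^'n^'n" and B :: "real^'m^'n" and C :: "real^'n^'p" and M :: "real^'n^'n"
  assumes M_sym: "transpose M = M" and horizon: "max_horizon A B C M = \<infinity>" and t: "0 \<le> t"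
  shows "aux_value A B C M t x \<in> semiconvex_transform_dom M"
proof -
  obtain W E :: "real^'n^'n" where WE: "\<And>x r. \<exists>xs ps. hamiltonian_pair A B C xs ps \<and> xs 0 = x \<and>
       xs t = E *v x - W *v r \<and> ps t = M *v xs t + r"
    using hamiltonian_pair_with_initial_state[OF max_horizon_infinite_invertible[OF horizon t]]
    by metis
  have ex: "\<exists>xs ps. hamiltonian_pair A B C xs ps \<and> xs 0 = x \<and> ps t = M *v (xs t - z)" for z
    using WE[of x "- (M *v z)"] by (auto simp: matrix_vector_mult_diff_distrib)
  define V where "V z = real_of_ereal (aux_value A B C M t x z)" for z
  have V: "aux_value A B C M t x z = ereal (V z)" for z
  proof -
    obtain xs ps where "hamiltonian_pair A B C xs ps" "xs 0 = x" "ps t = M *v (xs t - z)"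
      using ex by blast
    then show ?thesis using aux_value_eq[OF M_sym horizon t] by (metis V_def real_of_ereal.simps(1))
  qed
  define a where "a y z = basis_fun M y z - 1/2 * (z \<bullet> (M *v z))" for y z
  have M_comm: "a \<bullet> (M *v b) = b \<bullet> (M *v a)" for a b
    by (metis inner_matrix_vector_transpose inner_commute M_sym)
  have a: "a y z = 1/2 * (y \<bullet> (M *v y)) - z \<bullet> (M *v y)" for y z
    unfolding a_def basis_fun_def
    by (simp add: matrix_vector_mult_diff_distrib inner_diff_left inner_diff_right M_comm[of y z]
        algebra_simps)
  have "V ((1 - u) *\<^sub>R z1 + u *\<^sub>R z2) - 1/2 * (((1 - u) *\<^sub>R z1 + u *\<^sub>R z2) \<bullet> (M *v ((1 - u) *\<^sub>R z1 + u *\<^sub>R z2)))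
     \<le> (1 - u) * (V z1 - 1/2 * (z1 \<bullet> (M *v z1))) + u * (V z2 - 1/2 * (z2 \<bullet> (M *v z2)))"
    if u: "u \<in> {0<..<1}" for u z1 z2
  proof -
    let ?z = "(1 - u) *\<^sub>R z1 + u *\<^sub>R z2"
    obtain xs ps where hp: "hamiltonian_pair A B C xs ps" "xs 0 = x" "ps t = M *v (xs t - ?z)"
      using ex by blast
    note adm = hamiltonian_pair_admissible[OF hp(1) t]
    let ?J = "running_payoff C t (\<lambda>s. transpose B *v ps s) xs"
    have le: "?J + a (xs t) z \<le> V z - 1/2 * (z \<bullet> (M *v z))" for z
      using aux_value_ge[OF adm(1,2), of C M z] by (simp add: hp(2) V a_def)
    have "V ?z = 1/2 * (x \<bullet> ps 0 - ?z \<bullet> ps t)"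
      using aux_value_eq[OF M_sym horizon t hp(1,3)] by (simp add: hp(2) V)
    also have "\<dots> = ?J + basis_fun M (xs t) ?z"
      using hamiltonian_pair_value[OF hp(1) t hp(3)] by (simp add: hp(2))
    finally have "V ?z - 1/2 * (?z \<bullet> (M *v ?z)) = ?J + a (xs t) ?z"
      by (simp add: a_def)
    also have "\<dots> = (1 - u) * (?J + a (xs t) z1) + u * (?J + a (xs t) z2)"
    proof -
      have "?z \<bullet> m = (1 - u) * (z1 \<bullet> m) + u * (z2 \<bullet> m)" for m
        by (simp add: inner_add_left)
      then show ?thesis unfolding a by (simp only:) (simp add: field_simps)
    qed
    also have "\<dots> \<le> (1 - u) * (V z1 - 1/2 * (z1 \<bullet> (M *v z1))) + u * (V z2 - 1/2 * (z2 \<bullet> (M *v z2)))"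
      using u by (intro add_mono mult_left_mono le) auto
    finally show ?thesis .
  qed
  then show ?thesis
    unfolding semiconvex_transform_dom_def Rminus_valued_def Rminus_convex_def by (simp add: V)
qed

text \<open>One inequality is weak duality: a trajectory ending at \<open>y\<close> competes in \<open>S\<^sub>t(x, z)\<close> for every \<open>z\<close>.
  For the other, suppose that some characteristic joins \<open>x\<close> to \<open>y\<close>. As \<open>M\<close> is invertible, its
  terminal costate has the form \<open>M (y - z)\<close>, so the characteristic is optimal for \<open>S\<^sub>t(x, z)\<close> and
  there is no gap at this \<open>z\<close>. If none does, then \<open>E x - y\<close> lies outside the range of the symmetric
  matrix \<open>W\<close>, and moving \<open>z\<close> along a suitable kernel direction drives the transform to \<open>- \<infinity>\<close>.\<close>

lemma delta_evolution_eq_semiconvex_transform: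
  fixes A :: "real^'n^'n" and B :: "real^'m^'n" and C :: "real^'n^'p" and M :: "real^'n^'n"
  assumes M_sym: "transpose M = M" and M_inv: "invertible M"
    and horizon: "max_horizon A B C M = \<infinity>" and t: "0 \<le> t"
  shows "dp_evolution A B C t (\<lambda>\<xi>. maxplus_delta \<xi> y) x
    = semiconvex_transform M (aux_value A B C M t x) y"
proof -
  let ?G = "dp_evolution A B C t (\<lambda>\<xi>. maxplus_delta \<xi> y) x"
  obtain W E :: "real^'n^'n" where
    W0: "\<And>q. W *v q = 0 \<Longrightarrow> block12 (symplectic_flow A B C t) *v q = 0" and
    WE: "\<And>x r. \<exists>xs ps. hamiltonian_pair A B C xs ps \<and> xs 0 = x \<and>
       xs t = E *v x - W *v r \<and> ps t = M *v xs t + r"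
    using hamiltonian_pair_with_initial_state[OF max_horizon_infinite_invertible[OF horizon t]]
    by metis
  have M_comm: "a \<bullet> (M *v b) = b \<bullet> (M *v a)" for a b
    by (metis inner_matrix_vector_transpose inner_commute M_sym)
  have MZ: "M *v (matrix_inv M *v a) = a" for a
    by (simp add: matrix_vector_mul_assoc matrix_inv_cancel[OF M_inv])
  have W_sym: "(W *v a) \<bullet> b = (W *v b) \<bullet> a" for a b
  proof -
    obtain xa pa where 1: "hamiltonian_pair A B C xa pa" "xa 0 = 0" "xa t = - (W *v a)" "pa t = M *v xa t + a"
      using WE[of 0 a] by auto
    obtain xb pb where 2: "hamiltonian_pair A B C xb pb" "xb 0 = 0" "xb t = - (W *v b)" "pb t = M *v xb t + b"
      using WE[of 0 b] by auto
    have "xa t \<bullet> pb t = xb t \<bullet> pa t"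
      using wronskian_constant[OF 1(1) 2(1), of t 0] 1(2) 2(2) by simp
    then have "xa t \<bullet> b = xb t \<bullet> a"
      unfolding 1(4) 2(4) by (simp add: inner_add_right M_comm[of "xa t"])
    then show ?thesis by (simp add: 1(3) 2(3))
  qed
  have ex: "\<exists>xs ps. hamiltonian_pair A B C xs ps \<and> xs 0 = x \<and> ps t = M *v (xs t - z)" for z
    using WE[of x "- (M *v z)"] by (auto simp: matrix_vector_mult_diff_distrib)
  have fin: "\<exists>v. aux_value A B C M t x z = ereal v" for z
    using ex[of z] aux_value_eq[OF M_sym horizon t] by blast
  have basis_comm: "basis_fun M z y = basis_fun M y z" for z
    by (simp add: basis_fun_def matrix_vector_mult_diff_distrib inner_diff_left inner_diff_right)
  have weak: "?G \<le> semiconvex_transform M (aux_value A B C M t x) y"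
  proof -
    have "ereal (basis_fun M z y) + - aux_value A B C M t x z \<le> - ?G" for z
    proof -
      obtain v where v: "aux_value A B C M t x z = ereal v" using fin by blast
      have "?G \<le> ereal (v - basis_fun M z y)"
        unfolding dp_evolution_delta_le_iff
      proof (intro allI impI)
        fix w xs assume "w \<in> L2_on t" "state_trajectory A B t x w xs" "xs t = y"
        then show "ereal (running_payoff C t w xs) \<le> ereal (v - basis_fun M z y)"
          using aux_value_ge[of w t A B x xs C M z] by (simp add: v basis_comm)
      qed
      then have "- ereal (v - basis_fun M z y) \<le> - ?G" by (simp only: ereal_minus_le_minus)
      then show ?thesis
        by (simp add: v)
    qed
    then have "(SUP z. ereal (basis_fun M z y) + - aux_value A B C M t x z) \<le> - ?G"
      by (rule SUP_least)
    then show ?thesis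
      using ereal_minus_le_minus[of "- ?G" "SUP z. ereal (basis_fun M z y) + - aux_value A B C M t x z"]
      by (simp add: semiconvex_transform_def)
  qed
  have strong: "semiconvex_transform M (aux_value A B C M t x) y \<le> ?G"
  proof (cases "\<exists>r. W *v r = E *v x - y")
    case True
    then obtain r where "W *v r = E *v x - y" by blast
    then obtain xs ps where hp: "hamiltonian_pair A B C xs ps" "xs 0 = x" "xs t = y" "ps t = M *v y + r"
      using WE[of x r] by auto
    define z where "z = - (matrix_inv M *v r)"
    have pt: "ps t = M *v (xs t - z)"
      by (simp add: z_def hp matrix_vector_right_distrib MZ)
    note adm = hamiltonian_pair_admissible[OF hp(1) t]
    let ?J = "running_payoff C t (\<lambda>s. transpose B *v ps s) xs"
    have "aux_value A B C M t x z = ereal (?J + basis_fun M z y)"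
      using aux_value_eq[OF M_sym horizon t hp(1) pt] hamiltonian_pair_value[OF hp(1) t pt]
      by (simp add: hp(2,3) basis_comm)
    then have "ereal (- ?J) \<le> (SUP z. ereal (basis_fun M z y) + - aux_value A B C M t x z)"
      by (intro SUP_upper2[of z]) auto
    then have "semiconvex_transform M (aux_value A B C M t x) y \<le> ereal ?J"
      unfolding semiconvex_transform_def by (simp add: ereal_uminus_le_reorder)
    also have "\<dots> \<le> ?G"
      using dp_evolution_delta_le_iff[of A B C t y x ?G] adm(1,2) hp(2,3) by auto
    finally show ?thesis .
  next
    case False
    then obtain u where Wu: "W *v u = 0" and "u \<bullet> (E *v x - y) \<noteq> 0"
      using symmetric_matrix_solvable[of W "E *v x - y"] W_sym by metis
    then have d: "u \<bullet> (y - E *v x) \<noteq> 0" by (simp add: inner_diff_right)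
    \<comment> \<open>Terminal data \<open>(0, u)\<close> lead back to the initial state \<open>0\<close>; adding multiples of that characteristic changes \<open>z\<close> but neither endpoint.\<close>
    define z where "z = matrix_inv M *v u"
    have Mz: "M *v z = u" by (simp add: z_def MZ)
    obtain x1 p1 where 1: "hamiltonian_pair A B C x1 p1" "x1 0 = x" "x1 t = E *v x" "p1 t = M *v x1 t"
      using WE[of x 0] by auto
    obtain x2 p2 where "hamiltonian_pair A B C x2 p2" "x2 t = 0" "p2 t = u"
      "x2 0 = block11 (symplectic_flow A B C t) *v 0 + block12 (symplectic_flow A B C t) *v u"
      using hamiltonian_pair_with_terminal by blast
    then have 2: "hamiltonian_pair A B C x2 p2" "x2 0 = 0" "x2 t = 0" "p2 t = u"
      by (simp_all add: W0[OF Wu])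
    \<comment> \<open>This identity removes \<open>p2 0\<close> from the value, which makes the gap below affine in \<open>c\<close>.\<close>
    have wr: "x \<bullet> p2 0 = (E *v x) \<bullet> u"
      using wronskian_constant[OF 1(1) 2(1), of 0 t] 1 2 by simp
    have val: "basis_fun M (c *\<^sub>R z) y - (1/2 * (x \<bullet> p1 0 - 2 * c * ((E *v x) \<bullet> u) + c^2 * (z \<bullet> u)))
        = 1/2 * (y \<bullet> (M *v y)) - 1/2 * (x \<bullet> p1 0) - c * (u \<bullet> (y - E *v x))" for c
      unfolding basis_fun_def
      by (simp add: matrix_vector_mult_diff_distrib matrix_vector_mult_scaleR Mz inner_diff_left
          inner_diff_right M_comm[of z] inner_commute power2_eq_square algebra_simps)
    have aux: "aux_value A B C M t x (c *\<^sub>R z)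
        = ereal (1/2 * (x \<bullet> p1 0 - 2 * c * ((E *v x) \<bullet> u) + c^2 * (z \<bullet> u)))" for c
    proof -
      note hp = hamiltonian_pair_lincomb[OF 1(1) 2(1), of "- c"]
      have "p1 t + (-c) *\<^sub>R p2 t = M *v (x1 t + (-c) *\<^sub>R x2 t - c *\<^sub>R z)"
        by (simp add: 1 2 Mz matrix_vector_mult_diff_distrib matrix_vector_mult_scaleR)
      from aux_value_eq[OF M_sym horizon t hp this]
      show ?thesis
        by (simp add: 1 2 wr inner_add_right inner_diff_right M_comm[of z] Mz power2_eq_square algebra_simps)
    qed
    have "(SUP z. ereal (basis_fun M z y) + - aux_value A B C M t x z) = \<infinity>"
    proof (rule SUP_PInfty)
      fix n :: nat
      let ?k = "1/2 * (y \<bullet> (M *v y)) - 1/2 * (x \<bullet> p1 0)"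
      \<comment> \<open>The coefficient for which the affine gap equals \<open>n\<close>.\<close>
      define c where "c = (?k - real n) / (u \<bullet> (y - E *v x))"
      have "real n = ?k - c * (u \<bullet> (y - E *v x))" using d by (simp add: c_def)
      then have "ereal (real n) \<le> ereal (basis_fun M (c *\<^sub>R z) y) + - aux_value A B C M t x (c *\<^sub>R z)"
        using val[of c] unfolding aux by simp
      then show "\<exists>z\<in>UNIV. ereal (real n) \<le> ereal (basis_fun M z y) + - aux_value A B C M t x z"
        by blast
    qed
    then show ?thesis by (simp add: semiconvex_transform_def)
  qed
  show ?thesis using weak strong by (rule antisym)
qed

theorem mainTheorem1:
  fixes A :: "real^'n^'n" and B :: "real^'m^'n" and C :: "real^'n^'p"
    and M :: "real^'n^'n" and t :: real
  assumes M_sym: "transpose M = M"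
    and M_inv: "invertible M"
    and horizon: "max_horizon A B C M = \<infinity>"
    and t_nonneg: "t \<ge> 0"
  shows "\<exists>\<G> G.
      is_maxplus_integral_op \<G> G \<and>
      op_dom \<G> = op_dom (dp_evolution A B C t) \<and>
      (\<forall>\<psi>\<in>op_dom \<G>. dp_evolution A B C t \<psi> = \<G> \<psi>) \<and>
      (\<forall>x y. G x y = dp_evolution A B C t (\<lambda>\<xi>. maxplus_delta \<xi> y) x) \<and>
      (\<forall>x. aux_value A B C M t x \<in> semiconvex_transform_dom M) \<and>
      (\<forall>x y. G x y = semiconvex_transform M (aux_value A B C M t x) y)"
proof -
  define G where "G x y = dp_evolution A B C t (\<lambda>\<xi>. maxplus_delta \<xi> y) x" for x y
  note semi = aux_value_semiconvex[OF M_sym horizon t_nonneg]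
  note G_eq = delta_evolution_eq_semiconvex_transform[OF M_sym M_inv horizon t_nonneg]
  have fin: "G x y \<noteq> \<infinity>" for x y
  proof -
    \<comment> \<open>The basis function centred at \<open>y\<close> vanishes at \<open>y\<close>, so it dominates the delta function there.\<close>
    have "aux_value A B C M t x y \<noteq> \<infinity>"
      using semi[of x] by (auto simp: semiconvex_transform_dom_def Rminus_valued_def)
    moreover have "G x y \<le> aux_value A B C M t x y"
      unfolding G_def dp_evolution_delta_le_iff
      using aux_value_ge[of _ t A B x _ C M y] by (fastforce simp: basis_fun_def)
    ultimately show ?thesis by auto
  qed
  have eq: "dp_evolution A B C t \<psi> = maxplus_integral_op G \<psi>" if "Rminus_valued \<psi>" for \<psi>
    using dp_evolution_eq_maxplus_integral[OF fin[unfolded G_def] that] by (simp add: G_def[abs_def])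
  show ?thesis
  proof (intro exI[of _ "maxplus_integral_op G"] exI[of _ G] conjI)
    show "is_maxplus_integral_op (maxplus_integral_op G) G"
      using fin by (simp add: is_maxplus_integral_op_def Rminus_valued_def)
    show "op_dom (maxplus_integral_op G) = op_dom (dp_evolution A B C t)"
      using eq by (auto simp: op_dom_def)
    show "\<forall>\<psi>\<in>op_dom (maxplus_integral_op G). dp_evolution A B C t \<psi> = maxplus_integral_op G \<psi>"
      using eq by (auto simp: op_dom_def)
    show "\<forall>x y. G x y = dp_evolution A B C t (\<lambda>\<xi>. maxplus_delta \<xi> y) x"
      by (simp add: G_def)
    show "\<forall>x. aux_value A B C M t x \<in> semiconvex_transform_dom M"
      using semi by blast
    show "\<forall>x y. G x y = semiconvex_transform M (aux_value A B C M t x) y"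
      using G_eq by (simp add: G_def)
  qed
qed

end
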